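(* Let $\mathcal{C}$ be a finitary proto-abelian category. Let $\mathrm{iso}(\mathcal{C})$ be the set of isomorphism classes of objects of $\mathcal{C}$, and consider the free abelian group $$\mathrm{Hall}(\mathcal{C}) = \bigoplus_{[M] \in \mathrm{iso}(\mathcal{C})} \mathbb{Z}\,[M].$$ For objects $N, L, M$ of $\mathcal{C}$ let $g^M_{N,L}$ denote the number of subobjects $A \subset M$ such that $A \cong L$ and $M/A \cong N$. Then the bilinear extension of the formula $$[N]\cdot[L] = \sum_{[M]\in \mathrm{iso}(\mathcal{C})} g^M_{N,L}\,[M]$$ defines a unital associative multiplication law on $\mathrm{Hall}(\mathcal{C})$.
   Context: All categories are small. Monomorphisms are denoted $\hookrightarrow$ and epimorphisms $\twoheadrightarrow$. A category $\mathcal{C}$ is called proto-abelian if: (1) $\mathcal{C}$ is pointed (has a zero object $0$). (2)(a) Every diagram $C \twoheadleftarrow A \hookrightarrow B$ in $\mathcal{C}$ can be completed to a pushout square with $A\hookrightarrow B$, $A \twoheadrightarrow C$, $B \twoheadrightarrow D$, $C \hookrightarrow D$ (so the new maps $B\to D$ and $C \to D$ are epi and mono, respectively). (b) Every diagram $C \hookrightarrow D \twoheadleftarrow B$ in $\mathcal{C}$ can be completed to a pullback square with $A\hookrightarrow B$, $A \twoheadrightarrow C$, $B \twoheadrightarrow D$, $C \hookrightarrow D$. (3) A commutative square in $\mathcal{C}$ with $A\hookrightarrow B$, $A \twoheadrightarrow C$, $B \twoheadrightarrow D$, $C \hookrightarrow D$ is a pushout square if and only if it is a pullback square. A short exact sequence,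 or extension of $A'$ by $A$, is a pushout square in $\mathcal{C}$ with $A\hookrightarrow B$, $A \twoheadrightarrow 0$, $B \twoheadrightarrow A'$, $0 \hookrightarrow A'$; it is written $A \hookrightarrow B \twoheadrightarrow A'$. For a subobject $A\subset M$, $M/A$ denotes the pushout of $0 \twoheadleftarrow A \hookrightarrow M$. Two extensions $A \hookrightarrow B \twoheadrightarrow A'$ and $A \hookrightarrow C \twoheadrightarrow A'$ are equivalent if there is an isomorphism $B \cong C$ compatible with the identity maps of $A$ and of $A'$; $\mathrm{Ext}_{\mathcal{C}}(A',A)$ denotes the set of equivalence classes of extensions of $A'$ by $A$. A proto-abelian category $\mathcal{C}$ is called finitary if for every pair of objects $A, A'$ the sets $\mathrm{Hom}_{\mathcal{C}}(A',A)$ and $\mathrm{Ext}_{\mathcal{C}}(A',A)$ are finite. *)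

theory Defs
  imports "HOL-Algebra.Free_Abelian_Groups" "HOL-Algebra.Ring"
begin

section \<open>Small categories\<close>

text \<open>Objects and arrows form sets of two arbitrary types. Composition is written in the usual
  order (\<open>g \<bullet> f\<close> is ``first \<open>f\<close>, then \<open>g\<close>'') and is only meaningful if
  \<open>Cod f = Dom g\<close>.\<close>

record ('o, 'a) precategory =
  Obj :: "'o set"
  Arr :: "'a set"
  Dom :: "'a \<Rightarrow> 'o"
  Cod :: "'a \<Rightarrow> 'o"
  Ide :: "'o \<Rightarrow> 'a"
  Comp :: "'a \<Rightarrow> 'a \<Rightarrow> 'a"  (infixr \<open>\<bullet>\<index>\<close> 70)

definition homset :: "('o, 'a) precategory \<Rightarrow> 'o \<Rightarrow> 'o \<Rightarrow> 'a set" where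
  "homset C A B = {f \<in> Arr C. Dom C f = A \<and> Cod C f = B}"

locale category =
  fixes C :: "('o, 'a) precategory" (structure)
  assumes Dom_in: "f \<in> Arr C \<Longrightarrow> Dom C f \<in> Obj C"
    and Cod_in: "f \<in> Arr C \<Longrightarrow> Cod C f \<in> Obj C"
    and Ide_in: "A \<in> Obj C \<Longrightarrow> Ide C A \<in> homset C A A"
    and Comp_in: "f \<in> homset C A B \<Longrightarrow> g \<in> homset C B D \<Longrightarrow> g \<bullet> f \<in> homset C A D"
    and Comp_Ide: "f \<in> homset C A B \<Longrightarrow> f \<bullet> Ide C A = f"
    and Ide_Comp: "f \<in> homset C A B \<Longrightarrow> Ide C B \<bullet> f = f"
    and Comp_assoc: "f \<in> homset C A B \<Longrightarrow> g \<in> homset C B D \<Longrightarrow> h \<in> homset C D E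
      \<Longrightarrow> (h \<bullet> g) \<bullet> f = h \<bullet> (g \<bullet> f)"

definition monic :: "('o, 'a) precategory \<Rightarrow> 'a \<Rightarrow> bool" where
  "monic C f \<longleftrightarrow> f \<in> Arr C \<and>
    (\<forall>X \<in> Obj C. \<forall>g \<in> homset C X (Dom C f). \<forall>h \<in> homset C X (Dom C f).
      f \<bullet>\<^bsub>C\<^esub> g = f \<bullet>\<^bsub>C\<^esub> h \<longrightarrow> g = h)"

definition epic :: "('o, 'a) precategory \<Rightarrow> 'a \<Rightarrow> bool" where
  "epic C f \<longleftrightarrow> f \<in> Arr C \<and>
    (\<forall>X \<in> Obj C. \<forall>g \<in> homset C (Cod C f) X. \<forall>h \<in> homset C (Cod C f) X.
      g \<bullet>\<^bsub>C\<^esub> f = h \<bullet>\<^bsub>C\<^esub> f \<longrightarrow> g = h)"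

definition iso_arrow :: "('o, 'a) precategory \<Rightarrow> 'a \<Rightarrow> bool" where
  "iso_arrow C f \<longleftrightarrow> f \<in> Arr C \<and>
    (\<exists>g \<in> homset C (Cod C f) (Dom C f).
      g \<bullet>\<^bsub>C\<^esub> f = Ide C (Dom C f) \<and> f \<bullet>\<^bsub>C\<^esub> g = Ide C (Cod C f))"

definition isomorphic :: "('o, 'a) precategory \<Rightarrow> 'o \<Rightarrow> 'o \<Rightarrow> bool" where
  "isomorphic C A B \<longleftrightarrow> (\<exists>f \<in> homset C A B. iso_arrow C f)"

definition zero_object :: "('o, 'a) precategory \<Rightarrow> 'o \<Rightarrow> bool" where
  "zero_object C Z \<longleftrightarrow> Z \<in> Obj C \<and>
    (\<forall>X \<in> Obj C. (\<exists>!f. f \<in> homset C Z X) \<and> (\<exists>!f. f \<in> homset C X Z))"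

text \<open>The four arrows of a square are always listed in the order \<open>i p q j\<close>, where
  \<open>i : A \<rightarrow> B\<close>, \<open>p : A \<rightarrow> C\<close>, \<open>q : B \<rightarrow> D\<close>, \<open>j : C \<rightarrow> D\<close>.\<close>

definition comm_square :: "('o, 'a) precategory \<Rightarrow> 'a \<Rightarrow> 'a \<Rightarrow> 'a \<Rightarrow> 'a \<Rightarrow> bool" where
  "comm_square C i p q j \<longleftrightarrow>
    i \<in> Arr C \<and> p \<in> Arr C \<and> q \<in> Arr C \<and> j \<in> Arr C \<and>
    Dom C i = Dom C p \<and> Cod C i = Dom C q \<and> Cod C p = Dom C j \<and> Cod C q = Cod C j \<and>
    q \<bullet>\<^bsub>C\<^esub> i = j \<bullet>\<^bsub>C\<^esub> p"

definition pushout_square :: "('o, 'a) precategory \<Rightarrow> 'a \<Rightarrow> 'a \<Rightarrow> 'a \<Rightarrow> 'a \<Rightarrow> bool" where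
  "pushout_square C i p q j \<longleftrightarrow> comm_square C i p q j \<and>
    (\<forall>X \<in> Obj C. \<forall>u \<in> homset C (Cod C i) X. \<forall>v \<in> homset C (Cod C p) X.
      u \<bullet>\<^bsub>C\<^esub> i = v \<bullet>\<^bsub>C\<^esub> p \<longrightarrow>
      (\<exists>!w. w \<in> homset C (Cod C q) X \<and> w \<bullet>\<^bsub>C\<^esub> q = u \<and> w \<bullet>\<^bsub>C\<^esub> j = v))"

definition pullback_square :: "('o, 'a) precategory \<Rightarrow> 'a \<Rightarrow> 'a \<Rightarrow> 'a \<Rightarrow> 'a \<Rightarrow> bool" where
  "pullback_square C i p q j \<longleftrightarrow> comm_square C i p q j \<and>
    (\<forall>X \<in> Obj C. \<forall>u \<in> homset C X (Dom C q). \<forall>v \<in> homset C X (Dom C j).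
      q \<bullet>\<^bsub>C\<^esub> u = j \<bullet>\<^bsub>C\<^esub> v \<longrightarrow>
      (\<exists>!w. w \<in> homset C X (Dom C i) \<and> i \<bullet>\<^bsub>C\<^esub> w = u \<and> p \<bullet>\<^bsub>C\<^esub> w = v))"

section \<open>Proto-abelian categories\<close>

text \<open>The shape \<open>A \<hookrightarrow> B\<close>, \<open>A \<twoheadrightarrow> C\<close>, \<open>B \<twoheadrightarrow> D\<close>, \<open>C \<hookrightarrow> D\<close>.\<close>

definition mono_epi_shape :: "('o, 'a) precategory \<Rightarrow> 'a \<Rightarrow> 'a \<Rightarrow> 'a \<Rightarrow> 'a \<Rightarrow> bool" where
  "mono_epi_shape C i p q j \<longleftrightarrow> monic C i \<and> epic C p \<and> epic C q \<and> monic C j"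

locale proto_abelian = category C for C :: "('o, 'a) precategory" (structure) +
  assumes pointed: "\<exists>Z. zero_object C Z"
    and pushout_ex: "monic C i \<Longrightarrow> epic C p \<Longrightarrow> Dom C i = Dom C p
      \<Longrightarrow> \<exists>q j. mono_epi_shape C i p q j \<and> pushout_square C i p q j"
    and pullback_ex: "monic C j \<Longrightarrow> epic C q \<Longrightarrow> Cod C j = Cod C q
      \<Longrightarrow> \<exists>i p. mono_epi_shape C i p q j \<and> pullback_square C i p q j"
    and pushout_iff_pullback: "comm_square C i p q j \<Longrightarrow> mono_epi_shape C i p q j
      \<Longrightarrow> pushout_square C i p q j \<longleftrightarrow> pullback_square C i p q j"

text \<open>An extension \<open>A \<hookrightarrow> B \<twoheadrightarrow> A'\<close> of \<open>A'\<close> by \<open>A\<close> is recorded by its two arrows \<open>(i, q)\<close>; the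
  zero object in the corner and the two arrows \<open>z\<close>, \<open>z'\<close> at it carry no further information.\<close>

definition extensions :: "('o, 'a) precategory \<Rightarrow> 'o \<Rightarrow> 'o \<Rightarrow> ('a \<times> 'a) set" where
  "extensions C A' A = {(i, q). Dom C i = A \<and> Cod C q = A' \<and>
    (\<exists>z z'. zero_object C (Cod C z) \<and> mono_epi_shape C i z q z' \<and> pushout_square C i z q z')}"

definition ext_equiv :: "('o, 'a) precategory \<Rightarrow> 'o \<Rightarrow> 'o \<Rightarrow> (('a \<times> 'a) \<times> ('a \<times> 'a)) set" where
  "ext_equiv C A' A = {((i, q), (i', q')).
    (i, q) \<in> extensions C A' A \<and> (i', q') \<in> extensions C A' A \<and>
    (\<exists>f \<in> homset C (Cod C i) (Cod C i'). iso_arrow C f \<and> f \<bullet>\<^bsub>C\<^esub> i = i' \<and> q' \<bullet>\<^bsub>C\<^esub> f = q)}"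

definition Ext :: "('o, 'a) precategory \<Rightarrow> 'o \<Rightarrow> 'o \<Rightarrow> ('a \<times> 'a) set set" where
  "Ext C A' A = extensions C A' A // ext_equiv C A' A"

locale finitary_proto_abelian = proto_abelian C for C :: "('o, 'a) precategory" (structure) +
  assumes finite_hom: "A \<in> Obj C \<Longrightarrow> A' \<in> Obj C \<Longrightarrow> finite (homset C A' A)"
    and finite_Ext: "A \<in> Obj C \<Longrightarrow> A' \<in> Obj C \<Longrightarrow> finite (Ext C A' A)"

section \<open>Subobjects and the structure constants\<close>

text \<open>A subobject of \<open>M\<close> is a class of monomorphisms into \<open>M\<close> modulo isomorphism over \<open>M\<close>.\<close>

definition subobject_equiv :: "('o, 'a) precategory \<Rightarrow> 'o \<Rightarrow> ('a \<times> 'a) set" where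
  "subobject_equiv C M = {(f, f'). monic C f \<and> monic C f' \<and> Cod C f = M \<and> Cod C f' = M \<and>
    (\<exists>h \<in> homset C (Dom C f) (Dom C f'). iso_arrow C h \<and> f' \<bullet>\<^bsub>C\<^esub> h = f)}"

definition subobjects :: "('o, 'a) precategory \<Rightarrow> 'o \<Rightarrow> 'a set set" where
  "subobjects C M = {f. monic C f \<and> Cod C f = M} // subobject_equiv C M"

text \<open>\<open>Q\<close> is (a model of) the quotient \<open>M/A\<close> for the monomorphism \<open>f : A \<rightarrow> M\<close>, that is, a pushout
  of \<open>0 \<twoheadleftarrow> A \<hookrightarrow> M\<close>; such a \<open>Q\<close> is determined up to isomorphism only.\<close>

definition is_quotient :: "('o, 'a) precategory \<Rightarrow> 'a \<Rightarrow> 'o \<Rightarrow> bool" where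
  "is_quotient C f Q \<longleftrightarrow>
    (\<exists>z q z'. zero_object C (Cod C z) \<and> pushout_square C f z q z' \<and> Cod C q = Q)"

definition hall_subobjects :: "('o, 'a) precategory \<Rightarrow> 'o \<Rightarrow> 'o \<Rightarrow> 'o \<Rightarrow> 'a set set" where
  "hall_subobjects C N L M = {S \<in> subobjects C M.
    \<exists>f \<in> S. isomorphic C (Dom C f) L \<and> (\<exists>Q. is_quotient C f Q \<and> isomorphic C Q N)}"

text \<open>\<open>hall_number C N L M\<close> is \<open>g\<^sup>M\<^sub>N\<^sub>,\<^sub>L\<close>.\<close>

definition hall_number :: "('o, 'a) precategory \<Rightarrow> 'o \<Rightarrow> 'o \<Rightarrow> 'o \<Rightarrow> nat" where
  "hall_number C N L M = card (hall_subobjects C N L M)"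

section \<open>The Hall algebra\<close>

definition iso_rel :: "('o, 'a) precategory \<Rightarrow> ('o \<times> 'o) set" where
  "iso_rel C = {(A, B). A \<in> Obj C \<and> B \<in> Obj C \<and> isomorphic C A B}"

definition iso_class :: "('o, 'a) precategory \<Rightarrow> 'o \<Rightarrow> 'o set" where
  "iso_class C M = iso_rel C `` {M}"

definition iso_classes :: "('o, 'a) precategory \<Rightarrow> 'o set set" where
  "iso_classes C = Obj C // iso_rel C"

text \<open>The structure constants on isomorphism classes are computed on chosen representatives, and
  the sum below has its intended meaning only if finitely many of them are nonzero. Neither point
  is built into the definitions; both have to be proved for the product to be well defined.\<close>

definition class_number :: "('o, 'a) precategory \<Rightarrow> 'o set \<Rightarrow> 'o set \<Rightarrow> 'o set \<Rightarrow> nat" where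
  "class_number C n l m = hall_number C (SOME N. N \<in> n) (SOME L. L \<in> l) (SOME M. M \<in> m)"

definition hall_basis_mult :: "('o, 'a) precategory \<Rightarrow> 'o set \<Rightarrow> 'o set \<Rightarrow> ('o set \<Rightarrow>\<^sub>0 int)" where
  "hall_basis_mult C n l =
    (\<Sum>m \<in> {m \<in> iso_classes C. class_number C n l m \<noteq> 0}.
      frag_cmul (int (class_number C n l m)) (frag_of m))"

definition hall_mult ::
  "('o, 'a) precategory \<Rightarrow> ('o set \<Rightarrow>\<^sub>0 int) \<Rightarrow> ('o set \<Rightarrow>\<^sub>0 int) \<Rightarrow> ('o set \<Rightarrow>\<^sub>0 int)" where
  "hall_mult C x y = frag_extend (\<lambda>n. frag_extend (\<lambda>l. hall_basis_mult C n l) y) x"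

abbreviation Hall :: "('o, 'a) precategory \<Rightarrow> ('o set \<Rightarrow>\<^sub>0 int) monoid" where
  "Hall C \<equiv> free_Abelian_group (iso_classes C)"

definition hall_ring ::
  "('o, 'a) precategory \<Rightarrow> ('o set \<Rightarrow>\<^sub>0 int) \<Rightarrow> ('o set \<Rightarrow>\<^sub>0 int) ring" where
  "hall_ring C u = \<lparr>carrier = carrier (Hall C), mult = hall_mult C, one = u,
    zero = one (Hall C), add = mult (Hall C)\<rparr>"

end

theory Submission
  imports Defs
begin

text \<open>Both \<open>([N] \<cdot> [L]) \<cdot> [P]\<close> and \<open>[N] \<cdot> ([L] \<cdot> [P])\<close> have as coefficient of \<open>[M]\<close> the number of flags
  \<open>S \<subseteq> T \<subseteq> M\<close> with \<open>S \<cong> P\<close>, \<open>T/S \<cong> L\<close> and \<open>M/T \<cong> N\<close>, grouped by the class of \<open>M/S\<close> and by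
  the class of \<open>T\<close>, respectively. Grouping by \<open>M/S\<close> needs the bijection between the subobjects of
  \<open>M/S\<close> and the subobjects of \<open>M\<close> that contain \<open>S\<close>, which is given by the squares that are at once
  pushouts and pullbacks. Finiteness of the products comes from finiteness of \<open>Ext\<close>, and the class
  of a zero object is the unit.\<close>

section \<open>Categories\<close>

context category
begin

text \<open>Hom sets carry no addition, so kernels and cokernels cannot be tested by differences.
  Null arrows, those through a zero object, take over: a commutative square with a zero corner is a
  pushout iff \<open>q\<close> is a cokernel of \<open>i\<close>, and a pullback iff
  \<open>i\<close> is a kernel of \<open>q\<close>. For a mono followed by an epi,
  \<open>pushout_iff_pullback\<close> makes the two conditions equivalent, so exactness can be
  proved from either universal property and then yields both.

  The delicate point is the correspondence. Preimages along M \<rightarrow> M/S are pullbacks, but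
  image factorizations are not among the axioms, so a T containing S cannot simply be mapped to M/S.
  Instead T \<rightarrow> M is pushed out along T \<rightarrow> T/S, and the new epimorphism out of
  M is shown to be another cokernel of S.

  Quotients, pullbacks and pushouts are determined only up to isomorphism. Hence the conditions on
  subobjects are kept invariant under isomorphism, and the correspondence is a relation between
  monomorphisms that becomes a function only on their classes.\<close>

lemma homsetD:
  assumes "f \<in> homset C A B"
  shows "f \<in> Arr C" "Dom C f = A" "Cod C f = B" "A \<in> Obj C" "B \<in> Obj C"
  using assms Dom_in Cod_in by (auto simp: homset_def)

lemma homsetI [intro]: "f \<in> Arr C \<Longrightarrow> Dom C f = A \<Longrightarrow> Cod C f = B \<Longrightarrow> f \<in> homset C A B"
  by (auto simp: homset_def)

lemma comp_simps [simp]: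
  assumes "f \<in> Arr C" "g \<in> Arr C" "Dom C g = Cod C f"
  shows "g \<bullet> f \<in> Arr C" "Dom C (g \<bullet> f) = Dom C f" "Cod C (g \<bullet> f) = Cod C g"
  using Comp_in[of f "Dom C f" "Cod C f" g "Cod C g"] assms by (auto simp: homset_def)

lemma comp_assoc:
  assumes "f \<in> Arr C" "g \<in> Arr C" "h \<in> Arr C" "Dom C g = Cod C f" "Dom C h = Cod C g"
  shows "(h \<bullet> g) \<bullet> f = h \<bullet> g \<bullet> f"
  using assms by (intro Comp_assoc) auto

lemma Ide_simps [simp]:
  assumes "A \<in> Obj C"
  shows "Ide C A \<in> Arr C" "Dom C (Ide C A) = A" "Cod C (Ide C A) = A"
  using Ide_in[OF assms] by (auto simp: homset_def)

lemma comp_Ide_left [simp]: "f \<in> Arr C \<Longrightarrow> Cod C f = B \<Longrightarrow> Ide C B \<bullet> f = f"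
  and comp_Ide_right [simp]: "f \<in> Arr C \<Longrightarrow> Dom C f = A \<Longrightarrow> f \<bullet> Ide C A = f"
  by (auto intro: Ide_Comp Comp_Ide)

section \<open>Monomorphisms, epimorphisms and isomorphisms\<close>

lemma monic_arr: "monic C f \<Longrightarrow> f \<in> Arr C"
  and epic_arr: "epic C f \<Longrightarrow> f \<in> Arr C"
  by (auto simp: monic_def epic_def)

lemma monicD:
  assumes "monic C f" "f \<bullet> g = f \<bullet> h" "g \<in> Arr C" "h \<in> Arr C"
    "Cod C g = Dom C f" "Cod C h = Dom C f" "Dom C g = Dom C h"
  shows "g = h"
  using assms Dom_in[of g] unfolding monic_def by (auto simp: homset_def)

lemma epicD:
  assumes "epic C f" "g \<bullet> f = h \<bullet> f" "g \<in> Arr C" "h \<in> Arr C"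
    "Dom C g = Cod C f" "Dom C h = Cod C f" "Cod C g = Cod C h"
  shows "g = h"
  using assms Cod_in[of g] unfolding epic_def by (auto simp: homset_def)

lemma monicI:
  assumes "f \<in> Arr C"
    and "\<And>g h. g \<in> Arr C \<Longrightarrow> h \<in> Arr C \<Longrightarrow> Cod C g = Dom C f \<Longrightarrow> Cod C h = Dom C f \<Longrightarrow>
      Dom C g = Dom C h \<Longrightarrow> f \<bullet> g = f \<bullet> h \<Longrightarrow> g = h"
  shows "monic C f"
  using assms unfolding monic_def by (auto simp: homset_def)

lemma epicI:
  assumes "f \<in> Arr C"
    and "\<And>g h. g \<in> Arr C \<Longrightarrow> h \<in> Arr C \<Longrightarrow> Dom C g = Cod C f \<Longrightarrow> Dom C h = Cod C f \<Longrightarrow>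
      Cod C g = Cod C h \<Longrightarrow> g \<bullet> f = h \<bullet> f \<Longrightarrow> g = h"
  shows "epic C f"
  using assms unfolding epic_def by (auto simp: homset_def)

lemma monic_comp:
  assumes "monic C f" "monic C g" "Dom C g = Cod C f"
  shows "monic C (g \<bullet> f)"
proof (rule monicI)
  show "g \<bullet> f \<in> Arr C" using assms monic_arr by simp
  fix a b assume ab: "a \<in> Arr C" "b \<in> Arr C" "Cod C a = Dom C (g \<bullet> f)" "Cod C b = Dom C (g \<bullet> f)"
    "Dom C a = Dom C b" "(g \<bullet> f) \<bullet> a = (g \<bullet> f) \<bullet> b"
  note arr = assms(1,2)[THEN monic_arr]
  have "g \<bullet> f \<bullet> a = g \<bullet> f \<bullet> b" using ab assms arr by (simp add: comp_assoc)
  then have "f \<bullet> a = f \<bullet> b" by (rule monicD[OF assms(2)]) (use ab assms arr in auto)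
  then show "a = b" by (rule monicD[OF assms(1)]) (use ab assms arr in auto)
qed

lemma epic_comp:
  assumes "epic C f" "epic C g" "Dom C g = Cod C f"
  shows "epic C (g \<bullet> f)"
proof (rule epicI)
  note arr = assms(1,2)[THEN epic_arr]
  show "g \<bullet> f \<in> Arr C" using assms arr by simp
  fix a b assume ab: "a \<in> Arr C" "b \<in> Arr C" "Dom C a = Cod C (g \<bullet> f)" "Dom C b = Cod C (g \<bullet> f)"
    "Cod C a = Cod C b" "a \<bullet> g \<bullet> f = b \<bullet> g \<bullet> f"
  have "(a \<bullet> g) \<bullet> f = (b \<bullet> g) \<bullet> f" using ab assms arr by (simp add: comp_assoc)
  then have "a \<bullet> g = b \<bullet> g" by (rule epicD[OF assms(1)]) (use ab assms arr in auto)
  then show "a = b" by (rule epicD[OF assms(2)]) (use ab assms arr in auto)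
qed

lemma monic_factor:
  assumes "monic C (g \<bullet> f)" "f \<in> Arr C" "g \<in> Arr C" "Dom C g = Cod C f"
  shows "monic C f"
proof (rule monicI[OF assms(2)])
  fix a b assume ab: "a \<in> Arr C" "b \<in> Arr C" "Cod C a = Dom C f" "Cod C b = Dom C f"
    "Dom C a = Dom C b" "f \<bullet> a = f \<bullet> b"
  then have "(g \<bullet> f) \<bullet> a = (g \<bullet> f) \<bullet> b" using assms by (simp add: comp_assoc)
  then show "a = b" by (rule monicD[OF assms(1)]) (use ab assms in auto)
qed

lemma iso_arrowE:
  assumes "iso_arrow C f"
  obtains g where "f \<in> Arr C" "g \<in> Arr C" "Dom C g = Cod C f" "Cod C g = Dom C f"
    "g \<bullet> f = Ide C (Dom C f)" "f \<bullet> g = Ide C (Cod C f)" "iso_arrow C g"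
proof -
  obtain g where g: "f \<in> Arr C" "g \<in> Arr C" "Dom C g = Cod C f" "Cod C g = Dom C f"
    "g \<bullet> f = Ide C (Dom C f)" "f \<bullet> g = Ide C (Cod C f)"
    using assms unfolding iso_arrow_def homset_def by blast
  have "iso_arrow C g" using g unfolding iso_arrow_def homset_def
    by (intro conjI bexI[of _ f]) auto
  with g that show thesis by blast
qed

lemma iso_arrowI:
  assumes "f \<in> Arr C" "g \<in> Arr C" "Dom C g = Cod C f" "Cod C g = Dom C f"
    "g \<bullet> f = Ide C (Dom C f)" "f \<bullet> g = Ide C (Cod C f)"
  shows "iso_arrow C f"
  using assms unfolding iso_arrow_def homset_def by blast

lemma iso_monic: assumes "iso_arrow C f" shows "monic C f"
proof -
  obtain g where g: "f \<in> Arr C" "g \<in> Arr C" "Dom C g = Cod C f" "Cod C g = Dom C f"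
    "g \<bullet> f = Ide C (Dom C f)" using assms by (rule iso_arrowE)
  show ?thesis
  proof (rule monicI[OF g(1)])
    fix a b assume ab: "a \<in> Arr C" "b \<in> Arr C" "Cod C a = Dom C f" "Cod C b = Dom C f"
      "Dom C a = Dom C b" "f \<bullet> a = f \<bullet> b"
    have "(g \<bullet> f) \<bullet> a = (g \<bullet> f) \<bullet> b"
      using ab g(1-4) by (simp add: comp_assoc del: g(5))
    then show "a = b" using ab g by simp
  qed
qed

lemma iso_epic: assumes "iso_arrow C f" shows "epic C f"
proof -
  obtain g where g: "f \<in> Arr C" "g \<in> Arr C" "Dom C g = Cod C f" "Cod C g = Dom C f"
    "f \<bullet> g = Ide C (Cod C f)" using assms by (rule iso_arrowE)
  show ?thesis
  proof (rule epicI[OF g(1)])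
    fix a b assume ab: "a \<in> Arr C" "b \<in> Arr C" "Dom C a = Cod C f" "Dom C b = Cod C f"
      "Cod C a = Cod C b" "a \<bullet> f = b \<bullet> f"
    have "a \<bullet> f \<bullet> g = b \<bullet> f \<bullet> g"
      using ab g(1-4) comp_assoc by metis
    then show "a = b" using ab g by simp
  qed
qed

lemma iso_comp:
  assumes "iso_arrow C f" "iso_arrow C g" "Dom C g = Cod C f"
  shows "iso_arrow C (g \<bullet> f)"
proof -
  obtain f' where f: "f \<in> Arr C" "f' \<in> Arr C" "Dom C f' = Cod C f" "Cod C f' = Dom C f"
    "f' \<bullet> f = Ide C (Dom C f)" "f \<bullet> f' = Ide C (Cod C f)" using assms(1) by (rule iso_arrowE)
  obtain g' where g: "g \<in> Arr C" "g' \<in> Arr C" "Dom C g' = Cod C g" "Cod C g' = Dom C g"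
    "g' \<bullet> g = Ide C (Dom C g)" "g \<bullet> g' = Ide C (Cod C g)" using assms(2) by (rule iso_arrowE)
  have "(f' \<bullet> g') \<bullet> g \<bullet> f = f' \<bullet> (g' \<bullet> g) \<bullet> f"
    using f(1-4) g(1-4) assms(3) by (simp add: comp_assoc)
  also have "\<dots> = Ide C (Dom C f)" using f g assms(3) by simp
  finally have 1: "(f' \<bullet> g') \<bullet> g \<bullet> f = Ide C (Dom C f)" .
  have "(g \<bullet> f) \<bullet> f' \<bullet> g' = g \<bullet> (f \<bullet> f') \<bullet> g'"
    using f(1-4) g(1-4) assms(3) by (simp add: comp_assoc)
  also have "\<dots> = Ide C (Cod C g)" using f g assms(3) Cod_in[of f] by simp
  finally have 2: "(g \<bullet> f) \<bullet> f' \<bullet> g' = Ide C (Cod C g)" .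
  show ?thesis by (rule iso_arrowI[of _ "f' \<bullet> g'"]) (use f g assms(3) 1 2 in simp_all)
qed

lemma iso_Ide: "A \<in> Obj C \<Longrightarrow> iso_arrow C (Ide C A)"
  by (rule iso_arrowI[of _ "Ide C A"]) auto

section \<open>Isomorphism classes of objects\<close>

lemma isomorphicI: "iso_arrow C f \<Longrightarrow> isomorphic C (Dom C f) (Cod C f)"
  unfolding isomorphic_def by (auto simp: homset_def iso_arrow_def)

lemma isomorphicE:
  assumes "isomorphic C A B"
  obtains f where "iso_arrow C f" "f \<in> Arr C" "Dom C f = A" "Cod C f = B"
  using assms unfolding isomorphic_def by (auto simp: homset_def)

lemma isomorphic_refl: "A \<in> Obj C \<Longrightarrow> isomorphic C A A"
  using isomorphicI[OF iso_Ide] by simp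

lemma isomorphic_sym: "isomorphic C A B \<Longrightarrow> isomorphic C B A"
  by (metis isomorphicE isomorphicI iso_arrowE)

lemma isomorphic_trans: "isomorphic C A B \<Longrightarrow> isomorphic C B D \<Longrightarrow> isomorphic C A D"
  by (metis isomorphicE isomorphicI iso_comp comp_simps(2,3))

lemma equiv_iso_rel: "equiv (Obj C) (iso_rel C)"
  by (rule equivI)
    (auto simp: iso_rel_def refl_on_def sym_def trans_def
      intro: isomorphic_refl isomorphic_sym isomorphic_trans)

lemma iso_class_eq_iff: "A \<in> Obj C \<Longrightarrow> B \<in> Obj C \<Longrightarrow> iso_class C A = iso_class C B \<longleftrightarrow> isomorphic C A B"
  unfolding iso_class_def using eq_equiv_class_iff[OF equiv_iso_rel] by (simp add: iso_rel_def)

lemma iso_class_in [intro]: "A \<in> Obj C \<Longrightarrow> iso_class C A \<in> iso_classes C"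
  unfolding iso_class_def iso_classes_def by (rule quotientI)

lemma iso_class_self: "A \<in> Obj C \<Longrightarrow> A \<in> iso_class C A"
  by (simp add: iso_class_def iso_rel_def isomorphic_refl)

lemma iso_class_member:
  assumes "m \<in> iso_classes C" "M \<in> m"
  shows "M \<in> Obj C" "m = iso_class C M"
proof -
  obtain M0 where "m = iso_rel C `` {M0}" using assms(1) unfolding iso_classes_def by (rule quotientE)
  then have M0: "(M0, M) \<in> iso_rel C" "m = iso_class C M0" using assms(2) by (simp_all add: iso_class_def)
  show "M \<in> Obj C" using M0(1) by (simp add: iso_rel_def)
  show "m = iso_class C M"
    unfolding M0(2) iso_class_def by (rule equiv_class_eq[OF equiv_iso_rel M0(1)])
qed

subsection \<open>Subobjects\<close>

text \<open>Also applied to arrows that are not monic, where it says that \<open>f\<close> factors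
  through \<open>f'\<close>; the kernel property is stated in this form.\<close>

definition le_sub :: "'a \<Rightarrow> 'a \<Rightarrow> bool" where
  "le_sub f f' \<longleftrightarrow> (\<exists>h \<in> homset C (Dom C f) (Dom C f'). f' \<bullet> h = f)"

lemma le_subI: "h \<in> Arr C \<Longrightarrow> Dom C h = Dom C f \<Longrightarrow> Cod C h = Dom C f' \<Longrightarrow> f' \<bullet> h = f \<Longrightarrow> le_sub f f'"
  unfolding le_sub_def by auto

lemma le_subE:
  assumes "le_sub f f'"
  obtains h where "h \<in> Arr C" "Dom C h = Dom C f" "Cod C h = Dom C f'" "f' \<bullet> h = f"
  using assms unfolding le_sub_def by (auto simp: homset_def)

text \<open>Composing the two factorizations gives endomorphisms absorbed by \<open>f\<close> and by
  \<open>f'\<close>. Monicity cancels them to identities, so the comparison arrows are mutually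
  inverse.\<close>

lemma le_sub_antisym:
  assumes "monic C f" "monic C f'" "le_sub f f'" "le_sub f' f"
  obtains h where "iso_arrow C h" "h \<in> Arr C" "Dom C h = Dom C f" "Cod C h = Dom C f'" "f' \<bullet> h = f"
proof -
  obtain h where h: "h \<in> Arr C" "Dom C h = Dom C f" "Cod C h = Dom C f'" "f' \<bullet> h = f"
    using assms(3) by (rule le_subE)
  obtain k where k: "k \<in> Arr C" "Dom C k = Dom C f'" "Cod C k = Dom C f" "f \<bullet> k = f'"
    using assms(4) by (rule le_subE)
  note arr = assms(1,2)[THEN monic_arr] assms(1,2)[THEN monic_arr, THEN Dom_in]
  have "f \<bullet> k \<bullet> h = (f \<bullet> k) \<bullet> h" using h(1-3) k(1-3) arr by (simp add: comp_assoc)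
  also have "\<dots> = f" unfolding k h ..
  finally have *: "f \<bullet> k \<bullet> h = f" .
  have 1: "k \<bullet> h = Ide C (Dom C h)" by (rule monicD[OF assms(1)]) (use h(1-3) k(1-3) arr * in auto)
  have "f' \<bullet> h \<bullet> k = (f' \<bullet> h) \<bullet> k" using h(1-3) k(1-3) arr by (simp add: comp_assoc)
  also have "\<dots> = f'" unfolding k h ..
  finally have **: "f' \<bullet> h \<bullet> k = f'" .
  have 2: "h \<bullet> k = Ide C (Cod C h)" by (rule monicD[OF assms(2)]) (use h(1-3) k(1-3) arr ** in auto)
  have "iso_arrow C h" by (rule iso_arrowI[of _ k]) (use h k 1 2 in auto)
  with h that show thesis by blast
qed

text \<open>Trades the isomorphism of the definition for two factorizations. The result is visibly
  symmetric and is what the order lemmas \<open>le_sub_comp_iff\<close> and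
  \<open>sub_corr_le_iff\<close> can supply.\<close>

lemma subobject_equiv_iff:
  "(f, f') \<in> subobject_equiv C M \<longleftrightarrow>
    monic C f \<and> monic C f' \<and> Cod C f = M \<and> Cod C f' = M \<and> le_sub f f' \<and> le_sub f' f"
proof
  assume L: "(f, f') \<in> subobject_equiv C M"
  then obtain h where h: "iso_arrow C h" "Dom C h = Dom C f" "Cod C h = Dom C f'" "f' \<bullet> h = f"
    and m: "monic C f" "monic C f'" "Cod C f = M" "Cod C f' = M"
    by (auto simp: subobject_equiv_def homset_def)
  obtain k where k: "h \<in> Arr C" "k \<in> Arr C" "Dom C k = Cod C h" "Cod C k = Dom C h"
    "h \<bullet> k = Ide C (Cod C h)" using h(1) by (rule iso_arrowE)
  have "f \<bullet> k = f' \<bullet> h \<bullet> k" using h(2,3) k monic_arr[OF m(2)] unfolding h(4)[symmetric] by (simp add: comp_assoc)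
  also have "\<dots> = f'" using k h monic_arr[OF m(2)] by simp
  finally show "monic C f \<and> monic C f' \<and> Cod C f = M \<and> Cod C f' = M \<and> le_sub f f' \<and> le_sub f' f"
    using m h k by (auto intro: le_subI)
next
  assume "monic C f \<and> monic C f' \<and> Cod C f = M \<and> Cod C f' = M \<and> le_sub f f' \<and> le_sub f' f"
  then show "(f, f') \<in> subobject_equiv C M"
    by (auto simp: subobject_equiv_def homset_def elim!: le_sub_antisym[of f f'])
qed

lemma le_sub_refl: "f \<in> Arr C \<Longrightarrow> le_sub f f"
  by (rule le_subI[of "Ide C (Dom C f)"]) (auto simp: Dom_in)

lemma le_sub_trans:
  assumes "f'' \<in> Arr C" "le_sub f f'" "le_sub f' f''"
  shows "le_sub f f''"
proof -
  obtain h where h: "h \<in> Arr C" "Dom C h = Dom C f" "Cod C h = Dom C f'" "f' \<bullet> h = f"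
    using assms(2) by (rule le_subE)
  obtain k where k: "k \<in> Arr C" "Dom C k = Dom C f'" "Cod C k = Dom C f''" "f'' \<bullet> k = f'"
    using assms(3) by (rule le_subE)
  show ?thesis by (rule le_subI[of "k \<bullet> h"]) (use h k assms(1) comp_assoc[of h k f''] in auto)
qed

lemma equiv_subobject_equiv: "equiv {f. monic C f \<and> Cod C f = M} (subobject_equiv C M)"
  by (rule equivI)
    (auto simp: subobject_equiv_iff refl_on_def sym_def trans_def
      intro: le_sub_refl le_sub_trans monic_arr)

subsection \<open>Null arrows\<close>

text \<open>No zero object is fixed, so any of them may serve in the factorization;
  \<open>null_unique\<close> shows that the choice is immaterial.\<close>

definition null :: "'a \<Rightarrow> bool" where
  "null f \<longleftrightarrow> f \<in> Arr C \<and> (\<exists>Z a b. zero_object C Z \<and> a \<in> homset C (Dom C f) Z \<and>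
    b \<in> homset C Z (Cod C f) \<and> f = b \<bullet> a)"

lemma zero_objectD:
  assumes "zero_object C Z"
  shows "Z \<in> Obj C" "X \<in> Obj C \<Longrightarrow> \<exists>f. f \<in> homset C Z X" "X \<in> Obj C \<Longrightarrow> \<exists>f. f \<in> homset C X Z"
    "f \<in> homset C Z X \<Longrightarrow> g \<in> homset C Z X \<Longrightarrow> f = g"
    "f \<in> homset C X Z \<Longrightarrow> g \<in> homset C X Z \<Longrightarrow> f = g"
  using assms unfolding zero_object_def by (auto dest: homsetD(4,5)) (metis homsetD(4,5))+

text \<open>An arrow \<open>t\<close> between the two zero objects turns one factorization into the
  other. Every equation between null arrows with the same ends thereby becomes automatic.\<close>

lemma null_unique:
  assumes "null f" "null g" "Dom C f = Dom C g" "Cod C f = Cod C g"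
  shows "f = g"
proof -
  obtain Z a b where 1: "zero_object C Z" "a \<in> homset C (Dom C f) Z" "b \<in> homset C Z (Cod C f)" "f = b \<bullet> a"
    using assms(1) unfolding null_def by blast
  obtain Z' a' b' where 2: "zero_object C Z'" "a' \<in> homset C (Dom C f) Z'" "b' \<in> homset C Z' (Cod C f)" "g = b' \<bullet> a'"
    using assms(2,3,4) unfolding null_def by auto
  obtain t where t: "t \<in> homset C Z Z'" using zero_objectD(2)[OF 1(1)] zero_objectD(1)[OF 2(1)] by blast
  have "t \<bullet> a = a'" using zero_objectD(5)[OF 2(1)] Comp_in[OF 1(2) t] 2(2) by blast
  moreover have "b' \<bullet> t = b" using zero_objectD(4)[OF 1(1)] Comp_in[OF t 2(3)] 1(3) by blast
  ultimately show ?thesis using Comp_assoc[OF 1(2) t 2(3)] 1 2 by metis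
qed

lemma nullI:
  assumes "zero_object C Z" "a \<in> homset C A Z" "b \<in> homset C Z B" "f = b \<bullet> a"
  shows "null f"
  using homsetD[OF assms(2)] homsetD[OF assms(3)] assms unfolding null_def by auto

lemma null_comp_left:
  assumes "null f" "g \<in> Arr C" "Dom C g = Cod C f"
  shows "null (g \<bullet> f)"
proof -
  obtain Z a b where 1: "zero_object C Z" "a \<in> homset C (Dom C f) Z" "b \<in> homset C Z (Cod C f)" "f = b \<bullet> a"
    using assms(1) unfolding null_def by blast
  have g: "g \<in> homset C (Cod C f) (Cod C g)" using assms by auto
  have "g \<bullet> f = (g \<bullet> b) \<bullet> a" using Comp_assoc[OF 1(2,3) g] 1(4) by simp
  moreover have "g \<bullet> b \<in> homset C Z (Cod C g)" using Comp_in[OF 1(3) g] .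
  ultimately show ?thesis using nullI[OF 1(1,2)] by blast
qed

lemma null_comp_right:
  assumes "null f" "g \<in> Arr C" "Cod C g = Dom C f"
  shows "null (f \<bullet> g)"
proof -
  obtain Z a b where 1: "zero_object C Z" "a \<in> homset C (Dom C f) Z" "b \<in> homset C Z (Cod C f)" "f = b \<bullet> a"
    using assms(1) unfolding null_def by blast
  have g: "g \<in> homset C (Dom C g) (Dom C f)" using assms by auto
  have "f \<bullet> g = b \<bullet> a \<bullet> g" using Comp_assoc[OF g 1(2,3)] 1(4) by simp
  moreover have "a \<bullet> g \<in> homset C (Dom C g) Z" using Comp_in[OF g 1(2)] .
  ultimately show ?thesis using nullI[OF 1(1) _ 1(3)] by blast
qed

lemma null_to_zero: "f \<in> Arr C \<Longrightarrow> zero_object C (Cod C f) \<Longrightarrow> null f"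
  by (rule nullI[of "Cod C f" f "Dom C f" "Ide C (Cod C f)" "Cod C f"]) (auto simp: Cod_in)

lemma null_from_zero: "f \<in> Arr C \<Longrightarrow> zero_object C (Dom C f) \<Longrightarrow> null f"
  by (rule nullI[of "Dom C f" "Ide C (Dom C f)" "Dom C f" f "Cod C f"]) (auto simp: Dom_in)

lemma zero_monic: "f \<in> Arr C \<Longrightarrow> zero_object C (Dom C f) \<Longrightarrow> monic C f"
  by (rule monicI) (auto intro!: null_unique null_to_zero)

lemma zero_epic: "f \<in> Arr C \<Longrightarrow> zero_object C (Cod C f) \<Longrightarrow> epic C f"
  by (rule epicI) (auto intro!: null_unique null_from_zero)

lemma isomorphic_zero_iff:
  assumes "zero_object C Z"
  shows "isomorphic C X Z \<longleftrightarrow> zero_object C X"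
proof
  assume X: "zero_object C X"
  obtain f where f: "f \<in> homset C X Z" using assms X zero_objectD(1,2) by metis
  obtain g where g: "g \<in> homset C Z X" using assms X zero_objectD(1,2) by metis
  note fg = homsetD[OF f] homsetD[OF g]
  have "g \<bullet> f = Ide C X" by (rule zero_objectD(4)[OF X]) (use fg in auto)
  moreover have "f \<bullet> g = Ide C Z" by (rule zero_objectD(4)[OF assms]) (use fg in auto)
  ultimately have "iso_arrow C f" using fg by (intro iso_arrowI[of _ g]) auto
  then show "isomorphic C X Z" using isomorphicI fg by blast
next
  assume "isomorphic C X Z"
  then obtain f where f0: "iso_arrow C f" and d: "Dom C f = X" "Cod C f = Z" by (rule isomorphicE)
  obtain g where g: "f \<in> Arr C" "g \<in> Arr C" "Dom C g = Cod C f" "Cod C g = Dom C f"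
    "g \<bullet> f = Ide C (Dom C f)" using f0 by (rule iso_arrowE)
  note fg = g[unfolded d] d
  have X: "X \<in> Obj C" using Dom_in[OF fg(1)] d by simp
  \<comment> \<open>The identity of \<open>X\<close> equals \<open>g \<bullet> f\<close> and so
    passes through the zero object. Hence every arrow at \<open>X\<close> is null and therefore
    unique in its hom set.\<close>
  have *: "null (Ide C X)" using null_comp_left[OF null_to_zero[of f], of g] fg assms by simp
  have n: "null h" if "h \<in> Arr C" "Dom C h = X \<or> Cod C h = X" for h
    using that null_comp_left[OF *, of h] null_comp_right[OF *, of h] X by auto
  show "zero_object C X" unfolding zero_object_def
  proof (intro conjI ballI)
    fix Y assume Y: "Y \<in> Obj C"
    obtain a where a: "a \<in> homset C Z Y" using zero_objectD(2)[OF assms Y] by blast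
    obtain b where b: "b \<in> homset C Y Z" using zero_objectD(3)[OF assms Y] by blast
    show "\<exists>!h. h \<in> homset C X Y"
      by (rule ex1I[of _ "a \<bullet> f"]) (use homsetD[OF a] fg in \<open>auto simp: homset_def intro!: null_unique n\<close>)
    show "\<exists>!h. h \<in> homset C Y X"
      by (rule ex1I[of _ "g \<bullet> b"]) (use homsetD[OF b] fg in \<open>auto simp: homset_def intro!: null_unique n\<close>)
  qed (use X in auto)
qed

end

section \<open>Short exact sequences\<close>

context category
begin

text \<open>Dual of \<open>le_sub\<close> with the arguments in the same order: the first arrow
  factors through the second. Since \<open>u\<close> is arbitrary, this is the form of the cokernel
  property.\<close>

definition le_quot :: "'a \<Rightarrow> 'a \<Rightarrow> bool" where
  "le_quot u q \<longleftrightarrow> (\<exists>w \<in> homset C (Cod C q) (Cod C u). w \<bullet> q = u)"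

lemma le_quotI: "w \<in> Arr C \<Longrightarrow> Dom C w = Cod C q \<Longrightarrow> Cod C w = Cod C u \<Longrightarrow> w \<bullet> q = u \<Longrightarrow> le_quot u q"
  unfolding le_quot_def by auto

lemma le_quotE:
  assumes "le_quot u q"
  obtains w where "w \<in> Arr C" "Dom C w = Cod C q" "Cod C w = Cod C u" "w \<bullet> q = u"
  using assms unfolding le_quot_def by (auto simp: homset_def)

text \<open>Without subtraction, \<open>w\<close> is compared with an explicit null arrow
  \<open>b \<bullet> t\<close> of the same hom set, and \<open>q\<close> is cancelled.\<close>

lemma epic_null_cancel:
  assumes "epic C q" "null (w \<bullet> q)" "w \<in> Arr C" "Dom C w = Cod C q"
  shows "null w"
proof -
  note q = epic_arr[OF assms(1)]
  obtain Z a b where Z: "zero_object C Z" "a \<in> homset C (Dom C q) Z" "b \<in> homset C Z (Cod C w)"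
    using assms(2,3,4) q unfolding null_def by auto
  obtain t where t: "t \<in> homset C (Cod C q) Z" using zero_objectD(3)[OF Z(1) Cod_in[OF q]] by blast
  note arr = homsetD[OF t] homsetD[OF Z(3)]
  have n: "null (b \<bullet> t)" by (rule nullI[OF Z(1) t Z(3) refl])
  have "w = b \<bullet> t"
  proof (rule epicD[OF assms(1)])
    have "null ((b \<bullet> t) \<bullet> q)" by (rule null_comp_right[OF n q]) (use arr in auto)
    then show "w \<bullet> q = (b \<bullet> t) \<bullet> q" using assms q arr by (intro null_unique[OF assms(2)]) auto
  qed (use assms arr in auto)
  with n show ?thesis by simp
qed

section \<open>Universal properties of squares\<close>

lemma comm_squareD:
  assumes "comm_square C i p q j"
  shows "i \<in> Arr C" "p \<in> Arr C" "q \<in> Arr C" "j \<in> Arr C" "Dom C p = Dom C i" "Dom C q = Cod C i"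
    "Dom C j = Cod C p" "Cod C j = Cod C q" "q \<bullet> i = j \<bullet> p"
  using assms by (simp_all add: comm_square_def)

lemma pushoutE:
  assumes "pushout_square C i p q j" "u \<in> Arr C" "v \<in> Arr C" "Dom C u = Cod C i" "Dom C v = Cod C p"
    "Cod C v = Cod C u" "u \<bullet> i = v \<bullet> p"
  obtains w where "w \<in> Arr C" "Dom C w = Cod C q" "Cod C w = Cod C u" "w \<bullet> q = u" "w \<bullet> j = v"
proof -
  have "\<exists>!w. w \<in> homset C (Cod C q) (Cod C u) \<and> w \<bullet> q = u \<and> w \<bullet> j = v"
    using assms Cod_in[of u] unfolding pushout_square_def by (auto simp: homset_def)
  then show thesis using that by (auto simp: homset_def)
qed

lemma pullbackE:
  assumes "pullback_square C i p q j" "u \<in> Arr C" "v \<in> Arr C" "Cod C u = Dom C q" "Cod C v = Dom C j"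
    "Dom C v = Dom C u" "q \<bullet> u = j \<bullet> v"
  obtains w where "w \<in> Arr C" "Dom C w = Dom C u" "Cod C w = Dom C i" "i \<bullet> w = u" "p \<bullet> w = v"
proof -
  have "\<exists>!w. w \<in> homset C (Dom C u) (Dom C i) \<and> i \<bullet> w = u \<and> p \<bullet> w = v"
    using assms Dom_in[of u] unfolding pullback_square_def by (auto simp: homset_def)
  then show thesis using that by (auto simp: homset_def)
qed

text \<open>Monicity of \<open>i\<close> already makes a mediating arrow unique, which leaves
  existence as the only obligation.\<close>

lemma pullback_squareI:
  assumes "comm_square C i p q j" "monic C i"
    and "\<And>u v. u \<in> Arr C \<Longrightarrow> v \<in> Arr C \<Longrightarrow> Cod C u = Dom C q \<Longrightarrow> Cod C v = Dom C j \<Longrightarrow> Dom C v = Dom C u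
      \<Longrightarrow> q \<bullet> u = j \<bullet> v \<Longrightarrow>
      \<exists>w. w \<in> Arr C \<and> Dom C w = Dom C u \<and> Cod C w = Dom C i \<and> i \<bullet> w = u \<and> p \<bullet> w = v"
  shows "pullback_square C i p q j"
  unfolding pullback_square_def
proof (intro conjI ballI impI)
  fix X u v assume X: "X \<in> Obj C" and u: "u \<in> homset C X (Dom C q)" and v: "v \<in> homset C X (Dom C j)"
    and eq: "q \<bullet> u = j \<bullet> v"
  obtain w where w: "w \<in> Arr C" "Dom C w = X" "Cod C w = Dom C i" "i \<bullet> w = u" "p \<bullet> w = v"
    using assms(3)[of u v] homsetD[OF u] homsetD[OF v] eq by auto
  show "\<exists>!w. w \<in> homset C X (Dom C i) \<and> i \<bullet> w = u \<and> p \<bullet> w = v"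
  proof (rule ex1I[of _ w])
    fix w' assume "w' \<in> homset C X (Dom C i) \<and> i \<bullet> w' = u \<and> p \<bullet> w' = v"
    then show "w' = w" using w by (intro monicD[OF assms(2), of w' w]) (auto simp: homset_def)
  qed (use w in auto)
qed (rule assms(1))

lemma pushout_squareI:
  assumes "comm_square C i p q j" "epic C q"
    and "\<And>u v. u \<in> Arr C \<Longrightarrow> v \<in> Arr C \<Longrightarrow> Dom C u = Cod C i \<Longrightarrow> Dom C v = Cod C p \<Longrightarrow> Cod C v = Cod C u
      \<Longrightarrow> u \<bullet> i = v \<bullet> p \<Longrightarrow>
      \<exists>w. w \<in> Arr C \<and> Dom C w = Cod C q \<and> Cod C w = Cod C u \<and> w \<bullet> q = u \<and> w \<bullet> j = v"
  shows "pushout_square C i p q j"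
  unfolding pushout_square_def
proof (intro conjI ballI impI)
  fix X u v assume X: "X \<in> Obj C" and u: "u \<in> homset C (Cod C i) X" and v: "v \<in> homset C (Cod C p) X"
    and eq: "u \<bullet> i = v \<bullet> p"
  obtain w where w: "w \<in> Arr C" "Dom C w = Cod C q" "Cod C w = X" "w \<bullet> q = u" "w \<bullet> j = v"
    using assms(3)[of u v] homsetD[OF u] homsetD[OF v] eq by auto
  show "\<exists>!w. w \<in> homset C (Cod C q) X \<and> w \<bullet> q = u \<and> w \<bullet> j = v"
  proof (rule ex1I[of _ w])
    fix w' assume "w' \<in> homset C (Cod C q) X \<and> w' \<bullet> q = u \<and> w' \<bullet> j = v"
    then show "w' = w" using w by (intro epicD[OF assms(2), of w' w]) (auto simp: homset_def)
  qed (use w in auto)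
qed (rule assms(1))

end

text \<open>Isolates the condition that \<open>extensions\<close> puts on the two arrows, without
  fixing the outer objects.\<close>

definition exact :: "('o, 'a) precategory \<Rightarrow> 'a \<Rightarrow> 'a \<Rightarrow> bool" where
  "exact C i q \<longleftrightarrow> (\<exists>z z'. zero_object C (Cod C z) \<and> mono_epi_shape C i z q z' \<and> pushout_square C i z q z')"

lemma extensions_eq: "extensions C A' A = {(i, q). Dom C i = A \<and> Cod C q = A' \<and> exact C i q}"
  by (simp add: extensions_def exact_def)

context proto_abelian
begin

section \<open>Exact pairs as kernel-cokernel pairs\<close>

lemma exactD:
  assumes "exact C i q"
  shows "monic C i" "epic C q" "i \<in> Arr C" "q \<in> Arr C" "Dom C q = Cod C i" "null (q \<bullet> i)"
proof -
  obtain z z' where z: "zero_object C (Cod C z)" "mono_epi_shape C i z q z'" "pushout_square C i z q z'"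
    using assms unfolding exact_def by blast
  then show "monic C i" "epic C q" by (auto simp: mono_epi_shape_def)
  have c: "comm_square C i z q z'" using z by (simp add: pushout_square_def)
  show "i \<in> Arr C" "q \<in> Arr C" "Dom C q = Cod C i" using comm_squareD[OF c] by auto
  show "null (q \<bullet> i)" unfolding comm_squareD(9)[OF c] using comm_squareD[OF c] z(1)
    by (intro null_comp_left null_to_zero) auto
qed

lemma exact_cokernel:
  assumes "exact C i q" "u \<in> Arr C" "Dom C u = Cod C i" "null (u \<bullet> i)"
  shows "le_quot u q"
proof -
  obtain z z' where z: "zero_object C (Cod C z)" "mono_epi_shape C i z q z'" "pushout_square C i z q z'"
    using assms unfolding exact_def by blast
  then have c: "comm_square C i z q z'" by (simp add: pushout_square_def)
  note c' = comm_squareD[OF c]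
  obtain v where v: "v \<in> homset C (Cod C z) (Cod C u)" using zero_objectD(2)[OF z(1)] Cod_in[OF assms(2)] by blast
  note v' = homsetD[OF v]
  have "null (v \<bullet> z)" using c' v' z by (intro null_comp_left null_to_zero) auto
  then have "u \<bullet> i = v \<bullet> z" using assms c' v' by (intro null_unique) auto
  then obtain w where "w \<in> Arr C" "Dom C w = Cod C q" "Cod C w = Cod C u" "w \<bullet> q = u"
    using pushoutE[OF z(3), of u v] assms v' by auto
  then show ?thesis by (rule le_quotI)
qed

text \<open>The square behind \<open>exact\<close> is a pushout, hence a pullback by
  \<open>pushout_iff_pullback\<close>, and a pullback over a zero corner is a kernel.\<close>

lemma exact_kernel:
  assumes "exact C i q" "u \<in> Arr C" "Cod C u = Dom C q" "null (q \<bullet> u)"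
  shows "le_sub u i"
proof -
  obtain z z' where z: "zero_object C (Cod C z)" "mono_epi_shape C i z q z'" "pushout_square C i z q z'"
    using assms unfolding exact_def by blast
  then have c: "comm_square C i z q z'" by (simp add: pushout_square_def)
  have pb: "pullback_square C i z q z'" using pushout_iff_pullback[OF c z(2)] z(3) by simp
  note c' = comm_squareD[OF c]
  obtain v where v: "v \<in> homset C (Dom C u) (Cod C z)" using zero_objectD(3)[OF z(1)] Dom_in[OF assms(2)] by blast
  note v' = homsetD[OF v]
  have "null (z' \<bullet> v)" using c' v' z by (intro null_comp_left null_to_zero) auto
  then have "q \<bullet> u = z' \<bullet> v" using assms c' v' by (intro null_unique) auto
  then obtain w where "w \<in> Arr C" "Dom C w = Dom C u" "Cod C w = Dom C i" "i \<bullet> w = u"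
    using pullbackE[OF pb, of u v] assms c' v' by auto
  then show ?thesis by (rule le_subI)
qed

lemma zero_square:
  assumes "monic C i" "epic C q" "Dom C q = Cod C i" "null (q \<bullet> i)"
  obtains z z' where "zero_object C (Cod C z)" "mono_epi_shape C i z q z'" "comm_square C i z q z'"
proof -
  note arr = monic_arr[OF assms(1)] epic_arr[OF assms(2)]
  obtain Z where Z: "zero_object C Z" using pointed by blast
  obtain z where z: "z \<in> homset C (Dom C i) Z" using zero_objectD(3)[OF Z] Dom_in[OF arr(1)] by blast
  obtain z' where z': "z' \<in> homset C Z (Cod C q)" using zero_objectD(2)[OF Z] Cod_in[OF arr(2)] by blast
  note zz = homsetD[OF z] homsetD[OF z']
  have "null (z' \<bullet> z)" using Z zz by (intro null_comp_left null_to_zero) auto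
  then have "q \<bullet> i = z' \<bullet> z" using assms(3,4) zz arr by (intro null_unique) auto
  then have "comm_square C i z q z'" using zz arr assms(3) by (simp add: comm_square_def)
  moreover have "mono_epi_shape C i z q z'" using Z zz assms
    by (simp add: mono_epi_shape_def zero_monic zero_epic)
  ultimately show thesis using that Z zz by auto
qed

lemma exactI_cokernel:
  assumes "monic C i" "epic C q" "Dom C q = Cod C i" "null (q \<bullet> i)"
    and univ: "\<And>u. u \<in> Arr C \<Longrightarrow> Dom C u = Cod C i \<Longrightarrow> null (u \<bullet> i) \<Longrightarrow> le_quot u q"
  shows "exact C i q"
proof -
  obtain z z' where z: "zero_object C (Cod C z)" "mono_epi_shape C i z q z'" "comm_square C i z q z'"
    using zero_square[OF assms(1-4)] .
  note c = comm_squareD[OF z(3)]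
  have "pushout_square C i z q z'"
  proof (rule pushout_squareI[OF z(3) assms(2)])
    fix u v assume uv: "u \<in> Arr C" "v \<in> Arr C" "Dom C u = Cod C i" "Dom C v = Cod C z"
      "Cod C v = Cod C u" "u \<bullet> i = v \<bullet> z"
    have "null (u \<bullet> i)" unfolding uv(6) using uv(1-5) c z(1) by (intro null_comp_left null_to_zero) auto
    then obtain w where w: "w \<in> Arr C" "Dom C w = Cod C q" "Cod C w = Cod C u" "w \<bullet> q = u"
      using univ uv le_quotE by metis
    have "w \<bullet> z' = v" by (rule null_unique) (use w uv c z(1) in \<open>auto intro!: null_from_zero\<close>)
    with w show "\<exists>w. w \<in> Arr C \<and> Dom C w = Cod C q \<and> Cod C w = Cod C u \<and> w \<bullet> q = u \<and> w \<bullet> z' = v" by blast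
  qed
  with z show ?thesis unfolding exact_def by blast
qed

text \<open>The kernel property makes the square with the zero corner a pullback, and
  \<open>pushout_iff_pullback\<close> turns it into the pushout that \<open>exact\<close> asks
  for.\<close>

lemma exactI_kernel:
  assumes "monic C i" "epic C q" "Dom C q = Cod C i" "null (q \<bullet> i)"
    and univ: "\<And>u. u \<in> Arr C \<Longrightarrow> Cod C u = Dom C q \<Longrightarrow> null (q \<bullet> u) \<Longrightarrow> le_sub u i"
  shows "exact C i q"
proof -
  obtain z z' where z: "zero_object C (Cod C z)" "mono_epi_shape C i z q z'" "comm_square C i z q z'"
    using zero_square[OF assms(1-4)] .
  note c = comm_squareD[OF z(3)]
  have "pullback_square C i z q z'"
  proof (rule pullback_squareI[OF z(3) assms(1)])
    fix u v assume uv: "u \<in> Arr C" "v \<in> Arr C" "Cod C u = Dom C q" "Cod C v = Dom C z'"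
      "Dom C v = Dom C u" "q \<bullet> u = z' \<bullet> v"
    have "null (q \<bullet> u)" unfolding uv(6) using uv(1-5) c z(1) by (intro null_comp_left null_to_zero) auto
    then obtain w where w: "w \<in> Arr C" "Dom C w = Dom C u" "Cod C w = Dom C i" "i \<bullet> w = u"
      using univ uv le_subE by metis
    have "z \<bullet> w = v" by (rule null_unique) (use w uv c z(1) in \<open>auto intro!: null_to_zero\<close>)
    with w show "\<exists>w. w \<in> Arr C \<and> Dom C w = Dom C u \<and> Cod C w = Dom C i \<and> i \<bullet> w = u \<and> z \<bullet> w = v" by blast
  qed
  with z pushout_iff_pullback[OF z(3,2)] show ?thesis unfolding exact_def by blast
qed

lemma exact_ex:
  assumes "monic C i"
  obtains q where "exact C i q"
proof -
  obtain Z where Z: "zero_object C Z" using pointed by blast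
  obtain z where z: "z \<in> homset C (Dom C i) Z" using zero_objectD(3)[OF Z] Dom_in[OF monic_arr[OF assms]] by blast
  note z' = homsetD[OF z]
  have "epic C z" using zero_epic[of z] z' Z by simp
  then obtain q j where "mono_epi_shape C i z q j" "pushout_square C i z q j"
    using pushout_ex[OF assms, of z] z' by auto
  then have "exact C i q" unfolding exact_def using Z z' by blast
  then show thesis by (rule that)
qed

text \<open>\<open>is_quotient\<close> asks only for a pushout. The legs at the zero object are epic
  and monic anyway, and \<open>q\<close> is epic by the uniqueness part of the pushout
  property.\<close>

lemma is_quotient_iff:
  assumes "monic C f"
  shows "is_quotient C f Q \<longleftrightarrow> (\<exists>q. exact C f q \<and> Cod C q = Q)"
proof
  assume "is_quotient C f Q"
  then obtain z q z' where z: "zero_object C (Cod C z)" "pushout_square C f z q z'" "Cod C q = Q"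
    unfolding is_quotient_def by blast
  then have c: "comm_square C f z q z'" by (simp add: pushout_square_def)
  note c' = comm_squareD[OF c]
  have "monic C z'" using zero_monic[of z'] c' z by simp
  have "epic C z" using zero_epic[of z] c' z by simp
  have "epic C q"
  proof (rule epicI)
    fix a b assume ab: "a \<in> Arr C" "b \<in> Arr C" "Dom C a = Cod C q" "Dom C b = Cod C q" "Cod C a = Cod C b"
      "a \<bullet> q = b \<bullet> q"
    have 1: "b \<bullet> z' = a \<bullet> z'" using ab(1-5) c' z(1) by (intro null_unique null_from_zero) auto
    have "(a \<bullet> q) \<bullet> f = a \<bullet> (z' \<bullet> z)" using ab(1-5) c' by (simp add: comp_assoc)
    also have "\<dots> = (a \<bullet> z') \<bullet> z" using ab(1-5) c'(1-8) by (simp add: comp_assoc)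
    finally have 2: "(a \<bullet> q) \<bullet> f = (a \<bullet> z') \<bullet> z" .
    \<comment> \<open>\<open>a\<close> and \<open>b\<close> both mediate the same cocone: after
      \<open>q\<close> they agree by assumption, after \<open>z'\<close> because arrows out of a
      zero object are unique.\<close>
    have "\<exists>!w. w \<in> homset C (Cod C q) (Cod C a) \<and> w \<bullet> q = a \<bullet> q \<and> w \<bullet> z' = a \<bullet> z'"
      using z(2) 2 ab(1-5) c' Cod_in[of a] unfolding pushout_square_def by (auto simp: homset_def)
    then show "a = b" using ab 1 by (auto simp: homset_def)
  qed (use c' in simp)
  then have "exact C f q" using z(1,2) assms \<open>monic C z'\<close> \<open>epic C z\<close>
    unfolding exact_def mono_epi_shape_def by blast
  with z(3) show "\<exists>q. exact C f q \<and> Cod C q = Q" by blast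
qed (auto simp: exact_def is_quotient_def)

lemma exact_le_quot: "exact C i q \<Longrightarrow> exact C i q' \<Longrightarrow> le_quot q' q"
  by (rule exact_cokernel) (auto dest: exactD)

lemma exact_quot_unique:
  assumes "exact C i q" "exact C i q'"
  obtains k where "iso_arrow C k" "k \<in> Arr C" "Dom C k = Cod C q" "Cod C k = Cod C q'" "k \<bullet> q = q'"
proof -
  note e = exactD[OF assms(1)] exactD[OF assms(2)]
  obtain k where k: "k \<in> Arr C" "Dom C k = Cod C q" "Cod C k = Cod C q'" "k \<bullet> q = q'"
    using exact_le_quot[OF assms] by (rule le_quotE)
  obtain l where l: "l \<in> Arr C" "Dom C l = Cod C q'" "Cod C l = Cod C q" "l \<bullet> q' = q"
    using exact_le_quot[OF assms(2,1)] by (rule le_quotE)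
  have "(l \<bullet> k) \<bullet> q = l \<bullet> k \<bullet> q" using k(1-3) l(1-3) e by (simp add: comp_assoc)
  also have "\<dots> = q" unfolding k l ..
  finally have *: "(l \<bullet> k) \<bullet> q = q" .
  have 1: "l \<bullet> k = Ide C (Cod C q)"
    by (rule epicD[OF e(2)]) (use * k(1-3) l(1-3) e Cod_in[OF e(4)] in auto)
  have "(k \<bullet> l) \<bullet> q' = k \<bullet> l \<bullet> q'" using k(1-3) l(1-3) e by (simp add: comp_assoc)
  also have "\<dots> = q'" unfolding k l ..
  finally have **: "(k \<bullet> l) \<bullet> q' = q'" .
  have 2: "k \<bullet> l = Ide C (Cod C q')"
    by (rule epicD[OF e(8)]) (use ** k(1-3) l(1-3) e Cod_in[OF e(10)] in auto)
  have "iso_arrow C k" by (rule iso_arrowI[of _ l]) (use k l 1 2 in auto)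
  with k that show thesis by blast
qed

section \<open>Exactness under isomorphisms of the three terms\<close>

lemma exact_iso_right:
  assumes "exact C i q" "iso_arrow C c" "Dom C c = Cod C q"
  shows "exact C i (c \<bullet> q)"
proof -
  note e = exactD[OF assms(1)]
  obtain c' where c: "c \<in> Arr C" "c' \<in> Arr C" "Dom C c' = Cod C c" "Cod C c' = Dom C c" "c' \<bullet> c = Ide C (Dom C c)"
    using assms(2) by (rule iso_arrowE)
  show ?thesis
  proof (rule exactI_cokernel)
    show "epic C (c \<bullet> q)" using epic_comp[OF e(2) iso_epic[OF assms(2)]] assms(3) .
    show "null ((c \<bullet> q) \<bullet> i)" using null_comp_left[OF e(6) c(1)] e c assms(3) by (simp add: comp_assoc)
    fix u assume u: "u \<in> Arr C" "Dom C u = Cod C i" "null (u \<bullet> i)"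
    obtain w where w: "w \<in> Arr C" "Dom C w = Cod C q" "Cod C w = Cod C u" "w \<bullet> q = u"
      using exact_cokernel[OF assms(1) u] by (rule le_quotE)
    have "(w \<bullet> c') \<bullet> c \<bullet> q = w \<bullet> (c' \<bullet> c) \<bullet> q"
      using w(1-3) c(1-4) e assms(3) by (simp add: comp_assoc)
    also have "\<dots> = u" using c e assms(3) w by simp
    finally show "le_quot u (c \<bullet> q)" using w(1-3) c e assms(3) by (intro le_quotI[of "w \<bullet> c'"]) auto
  qed (use e c assms(3) in auto)
qed

lemma exact_iso_left:
  assumes "exact C i q" "iso_arrow C a" "Cod C a = Dom C i"
  shows "exact C (i \<bullet> a) q"
proof -
  note e = exactD[OF assms(1)]
  obtain a' where a: "a \<in> Arr C" "a' \<in> Arr C" "Dom C a' = Cod C a" "Cod C a' = Dom C a" "a \<bullet> a' = Ide C (Cod C a)"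
    using assms(2) by (rule iso_arrowE)
  show ?thesis
  proof (rule exactI_kernel)
    show "monic C (i \<bullet> a)" using monic_comp[OF iso_monic[OF assms(2)] e(1)] assms(3) by simp
    show "null (q \<bullet> i \<bullet> a)" using null_comp_right[OF e(6) a(1)] e a assms(3) by (simp add: comp_assoc)
    fix u assume u: "u \<in> Arr C" "Cod C u = Dom C q" "null (q \<bullet> u)"
    obtain w where w: "w \<in> Arr C" "Dom C w = Dom C u" "Cod C w = Dom C i" "i \<bullet> w = u"
      using exact_kernel[OF assms(1) u] by (rule le_subE)
    have "(i \<bullet> a) \<bullet> a' \<bullet> w = i \<bullet> (a \<bullet> a') \<bullet> w"
      using w(1-3) a(1-4) e assms(3) by (simp add: comp_assoc)
    also have "\<dots> = u" using a e assms(3) w by simp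
    finally show "le_sub u (i \<bullet> a)" using w(1-3) a e assms(3) by (intro le_subI[of "a' \<bullet> w"]) auto
  qed (use e a assms(3) in auto)
qed

text \<open>The new epimorphism is \<open>q \<bullet> b'\<close> with \<open>b'\<close> inverse to
  \<open>b\<close>, so the quotient object itself does not change.\<close>

lemma exact_iso_mid:
  assumes "exact C i q" "iso_arrow C b" "Dom C b = Cod C i"
  obtains q' where "exact C (b \<bullet> i) q'" "Cod C q' = Cod C q"
proof -
  note e = exactD[OF assms(1)]
  obtain b' where b: "b \<in> Arr C" "b' \<in> Arr C" "Dom C b' = Cod C b" "Cod C b' = Dom C b"
    "b' \<bullet> b = Ide C (Dom C b)" "b \<bullet> b' = Ide C (Cod C b)" "iso_arrow C b'"
    using assms(2) by (rule iso_arrowE)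
  have "exact C (b \<bullet> i) (q \<bullet> b')"
  proof (rule exactI_cokernel)
    show "monic C (b \<bullet> i)" using monic_comp[OF e(1) iso_monic[OF assms(2)]] assms(3) by simp
    show "epic C (q \<bullet> b')" using epic_comp[OF iso_epic[OF b(7)] e(2)] assms(3) e b by simp
    have "(q \<bullet> b') \<bullet> b \<bullet> i = q \<bullet> (b' \<bullet> b) \<bullet> i" using b(1-4) e assms(3) by (simp add: comp_assoc)
    also have "\<dots> = q \<bullet> i" using b e assms(3) by simp
    finally show "null ((q \<bullet> b') \<bullet> b \<bullet> i)" using e(6) by simp
    fix u assume u: "u \<in> Arr C" "Dom C u = Cod C (b \<bullet> i)" "null (u \<bullet> b \<bullet> i)"
    have du: "Dom C u = Cod C b" using u b e assms(3) by simp
    have "le_quot (u \<bullet> b) q"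
      by (rule exact_cokernel[OF assms(1)]) (use u(1,3) du b(1-4) e assms(3) in \<open>auto simp: comp_assoc\<close>)
    then obtain w where w: "w \<in> Arr C" "Dom C w = Cod C q" "Cod C w = Cod C u" "w \<bullet> q = u \<bullet> b"
      using u(1) du b(1) by (auto elim!: le_quotE)
    have "w \<bullet> q \<bullet> b' = (w \<bullet> q) \<bullet> b'" using w(1-3) b(1-4) e assms(3) by (simp add: comp_assoc)
    also have "\<dots> = u \<bullet> b \<bullet> b'" unfolding w(4) using du u(1) b(1-4) by (simp add: comp_assoc)
    also have "\<dots> = u" using b du u(1) by simp
    finally show "le_quot u (q \<bullet> b')" using w(1-3) b(1-4) e assms(3) by (intro le_quotI[of w]) auto
  qed (use e b assms(3) in auto)
  then show thesis by (rule that) (use e b assms(3) in auto)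
qed

end

section \<open>The correspondence between subobjects of a quotient and intermediate subobjects\<close>

context proto_abelian
begin

text \<open>\<open>sub_corr q x y\<close> says that the subobject \<open>x\<close> is the preimage of \<open>y\<close> under \<open>q\<close>.\<close>

definition sub_corr :: "'a \<Rightarrow> 'a \<Rightarrow> 'a \<Rightarrow> bool" where
  "sub_corr q x y \<longleftrightarrow> monic C x \<and> monic C y \<and> (\<exists>p. epic C p \<and> pullback_square C x p q y)"

lemma sub_corrE:
  assumes "sub_corr q x y"
  obtains p where "epic C p" "pullback_square C x p q y" "monic C x" "monic C y"
    "x \<in> Arr C" "p \<in> Arr C" "q \<in> Arr C" "y \<in> Arr C" "Dom C p = Dom C x" "Dom C q = Cod C x"
    "Dom C y = Cod C p" "Cod C y = Cod C q" "q \<bullet> x = y \<bullet> p"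
proof -
  obtain p where p: "epic C p" "pullback_square C x p q y" "monic C x" "monic C y"
    using assms unfolding sub_corr_def by blast
  then have "comm_square C x p q y" by (simp add: pullback_square_def)
  then show thesis using that[OF p] by (auto dest: comm_squareD)
qed

lemma sub_corr_pullback:
  assumes "epic C q" "monic C y" "Cod C y = Cod C q"
  obtains x where "sub_corr q x y"
  using pullback_ex[OF assms(2,1,3)] assms(2) that unfolding sub_corr_def mono_epi_shape_def by blast

text \<open>The passage from M to M/S, for a subobject \<open>x\<close> that contains
  \<open>s\<close> through \<open>f\<close>. Pushing \<open>x\<close> out along the quotient
  \<open>p\<close> of \<open>f\<close> gives a square that is also a pullback, but it ends in some
  epimorphism \<open>q'\<close> instead of \<open>q\<close>. As \<open>q'\<close> is again a
  cokernel of \<open>s\<close>, an isomorphism \<open>k\<close> with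
  \<open>k \<bullet> q' = q\<close> corrects \<open>y'\<close> to
  \<open>k \<bullet> y'\<close>.\<close>

lemma sub_corr_pushout:
  assumes "exact C s q" "monic C x" "f \<in> Arr C" "Cod C f = Dom C x" "x \<bullet> f = s"
  obtains y where "sub_corr q x y"
proof -
  note e = exactD[OF assms(1)]
  have x: "x \<in> Arr C" using assms(2) by (rule monic_arr)
  have "monic C f" using monic_factor[of x f] assms x e by simp
  then obtain p where p: "exact C f p" by (rule exact_ex)
  note ep = exactD[OF p]
  have dq: "Dom C q = Cod C x" using e assms(3-5) x by auto
  obtain q' y' where sh: "mono_epi_shape C x p q' y'" and po: "pushout_square C x p q' y'"
    using pushout_ex[OF assms(2) ep(2)] ep assms(4) by auto
  have cs: "comm_square C x p q' y'" using po by (simp add: pushout_square_def)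
  note c = comm_squareD[OF cs]
  have pb: "pullback_square C x p q' y'" using pushout_iff_pullback[OF cs sh] po by simp
  have q'e: "epic C q'" and y'm: "monic C y'" using sh by (auto simp: mono_epi_shape_def)
  have "q' \<bullet> s = (q' \<bullet> x) \<bullet> f" unfolding assms(5)[symmetric] using c(1-8) assms(3,4) by (simp add: comp_assoc)
  also have "\<dots> = y' \<bullet> p \<bullet> f" unfolding c(9) using c(1-8) assms(3,4) by (simp add: comp_assoc)
  finally have q's: "q' \<bullet> s = y' \<bullet> p \<bullet> f" .
  \<comment> \<open>If \<open>u\<close> kills \<open>s\<close>, then \<open>u \<bullet> x\<close>
    kills \<open>f\<close> and descends along \<open>p\<close> to some \<open>v\<close>; the pushout
    property glues \<open>u\<close> and \<open>v\<close> to an arrow out of the target of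
    \<open>q'\<close>.\<close>
  have "exact C s q'"
  proof (rule exactI_cokernel[OF e(1) q'e])
    show "null (q' \<bullet> s)" unfolding q's by (rule null_comp_left[OF ep(6)]) (use c assms ep in auto)
    fix u assume u: "u \<in> Arr C" "Dom C u = Cod C s" "null (u \<bullet> s)"
    have du: "Dom C u = Cod C x" using u e dq by simp
    have "u \<bullet> s = (u \<bullet> x) \<bullet> f" unfolding assms(5)[symmetric] using u(1) du x assms(3,4) by (simp add: comp_assoc)
    then have "le_quot (u \<bullet> x) p" using u(1,3) du x assms(3,4) by (intro exact_cokernel[OF p]) auto
    then obtain v where v: "v \<in> Arr C" "Dom C v = Cod C p" "Cod C v = Cod C u" "v \<bullet> p = u \<bullet> x"
      using u(1) du x by (auto elim!: le_quotE)
    obtain w where "w \<in> Arr C" "Dom C w = Cod C q'" "Cod C w = Cod C u" "w \<bullet> q' = u"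
      using pushoutE[OF po, of u v] u(1) du v by auto
    then show "le_quot u q'" by (rule le_quotI)
  qed (use c e dq in auto)
  then obtain k where k: "iso_arrow C k" "k \<in> Arr C" "Dom C k = Cod C q'" "Cod C k = Cod C q" "k \<bullet> q' = q"
    using exact_quot_unique assms(1) by metis
  have cs': "comm_square C x p q (k \<bullet> y')"
  proof -
    have "q \<bullet> x = k \<bullet> q' \<bullet> x" unfolding k(5)[symmetric] using c(1-8) k(1-4) by (simp add: comp_assoc)
    also have "\<dots> = (k \<bullet> y') \<bullet> p" unfolding c(9) using c(1-8) k(1-4) by (simp add: comp_assoc)
    finally show ?thesis using c(1-8) k(1-4) e dq by (simp add: comm_square_def)
  qed
  \<comment> \<open>Cancelling the monic \<open>k\<close> reduces this to the pullback property of
    the square with \<open>q'\<close> and \<open>y'\<close>.\<close>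
  have "pullback_square C x p q (k \<bullet> y')"
  proof (rule pullback_squareI[OF cs' assms(2)])
    fix u v assume uv: "u \<in> Arr C" "v \<in> Arr C" "Cod C u = Dom C q" "Cod C v = Dom C (k \<bullet> y')"
      "Dom C v = Dom C u" "q \<bullet> u = (k \<bullet> y') \<bullet> v"
    have dv: "Cod C v = Dom C y'" using uv(4) k(1-4) c(1-8) by simp
    have "k \<bullet> q' \<bullet> u = q \<bullet> u" unfolding k(5)[symmetric] using c(1-8) k(1-4) uv(1-3) dq by (simp add: comp_assoc)
    also have "\<dots> = k \<bullet> y' \<bullet> v" unfolding uv(6) using c(1-8) k(1-4) uv(1,2) dv by (simp add: comp_assoc)
    finally have "q' \<bullet> u = y' \<bullet> v"
      by (rule monicD[OF iso_monic[OF k(1)]]) (use c(1-8) k(1-4) uv(1-3,5) dv dq in auto)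
    then show "\<exists>w. w \<in> Arr C \<and> Dom C w = Dom C u \<and> Cod C w = Dom C x \<and> x \<bullet> w = u \<and> p \<bullet> w = v"
      using pullbackE[OF pb, of u v] uv(1-3,5) dv dq c by metis
  qed
  moreover have "monic C (k \<bullet> y')" using monic_comp[OF y'm iso_monic[OF k(1)]] k c by simp
  ultimately have "sub_corr q x (k \<bullet> y')" using assms(2) ep(2) unfolding sub_corr_def by blast
  then show thesis by (rule that)
qed

text \<open>Since \<open>q \<bullet> s\<close> is null, \<open>s\<close> and a null arrow into the
  domain of \<open>y\<close> form a cone over the pullback, and \<open>f\<close> is its mediating
  arrow. The outcome identifies T/S with the subobject \<open>y\<close> of M/S.\<close>

lemma sub_corr_exact:
  assumes "exact C s q" "sub_corr q x y"
  obtains f p where "exact C f p" "Cod C f = Dom C x" "x \<bullet> f = s" "Dom C f = Dom C s"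
    "Cod C p = Dom C y" "q \<bullet> x = y \<bullet> p"
proof -
  note e = exactD[OF assms(1)]
  obtain p where p: "epic C p" "pullback_square C x p q y" "monic C x" "monic C y"
    and c: "x \<in> Arr C" "p \<in> Arr C" "q \<in> Arr C" "y \<in> Arr C" "Dom C p = Dom C x" "Dom C q = Cod C x"
    "Dom C y = Cod C p" "Cod C y = Cod C q" and qx: "q \<bullet> x = y \<bullet> p" using assms(2) by (rule sub_corrE)
  obtain Z where Z: "zero_object C Z" using pointed by blast
  obtain a where a: "a \<in> homset C (Dom C s) Z" using zero_objectD(3)[OF Z] Dom_in[OF e(3)] by blast
  obtain b where b: "b \<in> homset C Z (Dom C y)" using zero_objectD(2)[OF Z] Dom_in[OF c(4)] by blast
  note ab = homsetD[OF a] homsetD[OF b]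
  have n: "null (b \<bullet> a)" by (rule nullI[OF Z a b refl])
  have "null (y \<bullet> b \<bullet> a)" by (rule null_comp_left[OF n c(4)]) (use ab in auto)
  then have "q \<bullet> s = y \<bullet> b \<bullet> a" using e c ab by (intro null_unique) auto
  then obtain f where f: "f \<in> Arr C" "Dom C f = Dom C s" "Cod C f = Dom C x" "x \<bullet> f = s" "p \<bullet> f = b \<bullet> a"
    using pullbackE[OF p(2), of s "b \<bullet> a"] e c ab by auto
  have "monic C f" using monic_factor[of x f] f c e by simp
  \<comment> \<open>If \<open>p\<close> kills \<open>u\<close>, then \<open>q\<close> kills
    \<open>x \<bullet> u\<close>, which therefore factors through \<open>s = x \<bullet> f\<close>;
    cancelling \<open>x\<close> makes \<open>u\<close> factor through \<open>f\<close>.\<close>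
  have "exact C f p"
  proof (rule exactI_kernel[OF \<open>monic C f\<close> p(1)])
    show "null (p \<bullet> f)" using n f(5) by simp
    fix u assume u: "u \<in> Arr C" "Cod C u = Dom C p" "null (p \<bullet> u)"
    have "null (y \<bullet> p \<bullet> u)" by (rule null_comp_left[OF u(3) c(4)]) (use c u in auto)
    moreover have "q \<bullet> x \<bullet> u = (q \<bullet> x) \<bullet> u" using c u by (simp add: comp_assoc)
    moreover have "(q \<bullet> x) \<bullet> u = y \<bullet> p \<bullet> u" unfolding qx using c u by (simp add: comp_assoc)
    ultimately have "le_sub (x \<bullet> u) s" using c u by (intro exact_kernel[OF assms(1)]) auto
    then obtain h where h: "h \<in> Arr C" "Dom C h = Dom C u" "Cod C h = Dom C s" "s \<bullet> h = x \<bullet> u"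
      using c u by (auto elim!: le_subE)
    have "x \<bullet> f \<bullet> h = (x \<bullet> f) \<bullet> h" using c f(1-3) h(1-3) by (simp add: comp_assoc)
    also have "\<dots> = x \<bullet> u" unfolding f(4) by (rule h(4))
    finally have "f \<bullet> h = u" by (rule monicD[OF p(3)]) (use c u f(1-3) h(1-3) in auto)
    then show "le_sub u f" using h f by (intro le_subI[of h]) auto
  qed (use c f in auto)
  then show thesis by (rule that) (use f c qx in auto)
qed

text \<open>From right to left, the pullback over \<open>y'\<close> yields the comparison. From left
  to right, \<open>h\<close> carries \<open>f\<close> to \<open>f'\<close> and so induces an arrow
  between their cokernels. The equivalence makes the correspondence both well defined and injective
  on classes.\<close>

lemma sub_corr_le_iff:
  assumes "exact C s q" "sub_corr q x y" "sub_corr q x' y'"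
  shows "le_sub x x' \<longleftrightarrow> le_sub y y'"
proof
  assume L: "le_sub y y'"
  obtain p where p: "epic C p" "pullback_square C x p q y" "monic C x" "monic C y"
    and c: "x \<in> Arr C" "p \<in> Arr C" "q \<in> Arr C" "y \<in> Arr C" "Dom C p = Dom C x" "Dom C q = Cod C x"
    "Dom C y = Cod C p" "Cod C y = Cod C q" and qx: "q \<bullet> x = y \<bullet> p" using assms(2) by (rule sub_corrE)
  obtain p' where p': "epic C p'" "pullback_square C x' p' q y'"
    and c': "x' \<in> Arr C" "p' \<in> Arr C" "y' \<in> Arr C" "Dom C p' = Dom C x'" "Dom C q = Cod C x'"
    "Dom C y' = Cod C p'" "Cod C y' = Cod C q" using assms(3) by (rule sub_corrE)
  obtain g where g: "g \<in> Arr C" "Dom C g = Dom C y" "Cod C g = Dom C y'" "y' \<bullet> g = y" using L by (rule le_subE)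
  have "q \<bullet> x = y' \<bullet> g \<bullet> p" unfolding qx g(4)[symmetric] using c c' g(1-3) by (simp add: comp_assoc)
  then obtain h where "h \<in> Arr C" "Dom C h = Dom C x" "Cod C h = Dom C x'" "x' \<bullet> h = x"
    using pullbackE[OF p'(2), of x "g \<bullet> p"] c c' g by auto
  then show "le_sub x x'" by (rule le_subI)
next
  assume L: "le_sub x x'"
  obtain f p where p: "exact C f p" "Cod C f = Dom C x" "x \<bullet> f = s" "Dom C f = Dom C s"
    "Cod C p = Dom C y" "q \<bullet> x = y \<bullet> p" using sub_corr_exact[OF assms(1,2)] .
  obtain f' p' where p': "exact C f' p'" "Cod C f' = Dom C x'" "x' \<bullet> f' = s" "Dom C f' = Dom C s"
    "Cod C p' = Dom C y'" "q \<bullet> x' = y' \<bullet> p'" using sub_corr_exact[OF assms(1,3)] .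
  note e = exactD[OF p(1)] exactD[OF p'(1)] exactD[OF assms(1)]
  have c: "x \<in> Arr C" "x' \<in> Arr C" "y \<in> Arr C" "y' \<in> Arr C" "Dom C q = Cod C x" "Dom C q = Cod C x'"
    "Cod C y = Cod C q" "Cod C y' = Cod C q" "monic C x'" using assms(2,3) by (auto elim!: sub_corrE)
  obtain h where h: "h \<in> Arr C" "Dom C h = Dom C x" "Cod C h = Dom C x'" "x' \<bullet> h = x" using L by (rule le_subE)
  have "x' \<bullet> h \<bullet> f = (x' \<bullet> h) \<bullet> f" using h(1-3) c e p(2) by (simp add: comp_assoc)
  also have "\<dots> = x' \<bullet> f'" unfolding h(4) p(3) p'(3) ..
  finally have hf: "h \<bullet> f = f'" by (rule monicD[OF c(9)]) (use h(1-3) c e p(2,4) p'(2,4) in auto)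
  have "(p' \<bullet> h) \<bullet> f = p' \<bullet> f'" unfolding hf[symmetric] using h(1-3) e p(2) p'(2) by (simp add: comp_assoc)
  then have "le_quot (p' \<bullet> h) p" using h(1-3) e p(2) p'(2) by (intro exact_cokernel[OF p(1)]) auto
  then obtain g where g: "g \<in> Arr C" "Dom C g = Dom C y" "Cod C g = Dom C y'" "g \<bullet> p = p' \<bullet> h"
    using h(1-3) e p(2,5) p'(2,5) by (auto elim!: le_quotE)
  have "(y' \<bullet> g) \<bullet> p = y' \<bullet> p' \<bullet> h" unfolding g(4)[symmetric] using g(1-3) c e p(5) by (simp add: comp_assoc)
  also have "\<dots> = (y' \<bullet> p') \<bullet> h" using h(1-3) c e p'(2,5) by (simp add: comp_assoc)
  also have "\<dots> = q \<bullet> x' \<bullet> h" unfolding p'(6)[symmetric] using h(1-3) c e by (simp add: comp_assoc)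
  also have "\<dots> = y \<bullet> p" unfolding h(4) p(6) ..
  finally have "y' \<bullet> g = y" by (rule epicD[OF e(2)]) (use g(1-3) c p(5) e in auto)
  with g show "le_sub y y'" by (intro le_subI[of g]) auto
qed

text \<open>The third isomorphism theorem, (M/S)/(T/S) = M/T. An arrow that kills \<open>x\<close>
  kills \<open>s\<close> and descends along \<open>q\<close> to some \<open>v\<close>; then
  \<open>v \<bullet> y\<close> is null because \<open>p\<close> is epic, so \<open>v\<close>
  descends along \<open>r\<close>.\<close>

lemma sub_corr_quotient:
  assumes "exact C s q" "sub_corr q x y" "exact C y r"
  shows "exact C x (r \<bullet> q)"
proof -
  obtain f p where p: "exact C f p" "Cod C f = Dom C x" "x \<bullet> f = s" "Dom C f = Dom C s"
    "Cod C p = Dom C y" "q \<bullet> x = y \<bullet> p" using sub_corr_exact[OF assms(1,2)] .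
  note e = exactD[OF p(1)] exactD[OF assms(1)] exactD[OF assms(3)]
  have c: "x \<in> Arr C" "y \<in> Arr C" "Dom C q = Cod C x" "Cod C y = Cod C q" "monic C x"
    using assms(2) by (auto elim!: sub_corrE)
  show ?thesis
  proof (rule exactI_cokernel[OF c(5)])
    show "epic C (r \<bullet> q)" using epic_comp e c by simp
    have "(r \<bullet> q) \<bullet> x = r \<bullet> y \<bullet> p" unfolding p(6)[symmetric] using e c by (simp add: comp_assoc)
    also have "\<dots> = (r \<bullet> y) \<bullet> p" using e c p(5) by (simp add: comp_assoc)
    finally show "null ((r \<bullet> q) \<bullet> x)" using null_comp_right[of "r \<bullet> y" p] e c p(5) by simp
    fix u assume u: "u \<in> Arr C" "Dom C u = Cod C x" "null (u \<bullet> x)"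
    have "u \<bullet> s = (u \<bullet> x) \<bullet> f" unfolding p(3)[symmetric] using u(1,2) c e p(2) by (simp add: comp_assoc)
    then have "le_quot u q" using null_comp_right[OF u(3), of f] u(1,2) c e p(2)
      by (intro exact_cokernel[OF assms(1)]) auto
    then obtain v where v: "v \<in> Arr C" "Dom C v = Cod C q" "Cod C v = Cod C u" "v \<bullet> q = u" by (rule le_quotE)
    have "(v \<bullet> y) \<bullet> p = v \<bullet> q \<bullet> x" unfolding p(6) using v(1-3) c e p(5) by (simp add: comp_assoc)
    also have "\<dots> = u \<bullet> x" unfolding v(4)[symmetric] using v(1-3) c e by (simp add: comp_assoc)
    finally have "null ((v \<bullet> y) \<bullet> p)" using u(3) by simp
    then have "null (v \<bullet> y)" by (rule epic_null_cancel[OF e(2)]) (use v(1-3) c e p(5) in auto)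
    then have "le_quot v r" using v(1-3) c e by (intro exact_cokernel[OF assms(3)]) auto
    then obtain w where w: "w \<in> Arr C" "Dom C w = Cod C r" "Cod C w = Cod C v" "w \<bullet> r = v" by (rule le_quotE)
    have "w \<bullet> r \<bullet> q = (w \<bullet> r) \<bullet> q" using w(1-3) e c by (simp add: comp_assoc)
    also have "\<dots> = u" unfolding w(4) by (rule v(4))
    finally show "le_quot u (r \<bullet> q)" using w(1-3) v(1-3) e c by (intro le_quotI[of w]) auto
  qed (use e c in auto)
qed

end

section \<open>Counting subobjects\<close>

text \<open>\<open>R\<close> need not be functional, since preimages are determined only up to
  isomorphism; a choice \<open>g\<close> within \<open>R\<close> induces the map. The congruence
  gives well-definedness from one direction and injectivity from the other. Classes may leave
  \<open>A\<close>, where \<open>g\<close> is uncontrolled, hence \<open>X \<inter> A\<close> in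
  \<open>F\<close>.\<close>

lemma bij_betw_quotient:
  assumes "equiv U E" "equiv U' E'" "A \<subseteq> U" "A' \<subseteq> U'"
    and l: "\<And>a. a \<in> A \<Longrightarrow> \<exists>b \<in> A'. R a b" and r: "\<And>b. b \<in> A' \<Longrightarrow> \<exists>a \<in> A. R a b"
    and cong: "\<And>a a' b b'. R a b \<Longrightarrow> R a' b' \<Longrightarrow> a \<in> A \<Longrightarrow> a' \<in> A \<Longrightarrow> b \<in> A' \<Longrightarrow> b' \<in> A' \<Longrightarrow>
      (a, a') \<in> E \<longleftrightarrow> (b, b') \<in> E'"
  shows "\<exists>F. bij_betw F (A // E) (A' // E')"
proof -
  obtain g where g: "\<And>a. a \<in> A \<Longrightarrow> g a \<in> A' \<and> R a (g a)" using l by metis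
  define F where "F X = E' `` (g ` (X \<inter> A))" for X
  have gE: "(g a, g a') \<in> E' \<longleftrightarrow> (a, a') \<in> E" if "a \<in> A" "a' \<in> A" for a a'
    using cong[of a "g a" a' "g a'"] g that by blast
  have F: "F (E `` {a}) = E' `` {g a}" if a: "a \<in> A" for a
  proof
    show "F (E `` {a}) \<subseteq> E' `` {g a}"
    proof
      fix b assume "b \<in> F (E `` {a})"
      then obtain a' where a': "(a, a') \<in> E" "a' \<in> A" "(g a', b) \<in> E'" by (auto simp: F_def)
      then have "(g a, g a') \<in> E'" using gE a by blast
      then show "b \<in> E' `` {g a}" using a'(3) equivE[OF assms(2)] by (auto dest: transD)
    qed
    have "(a, a) \<in> E" using a assms(1,3) by (auto simp: equiv_def refl_on_def)
    then show "E' `` {g a} \<subseteq> F (E `` {a})" using a by (auto simp: F_def)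
  qed
  have "inj_on F (A // E)"
  proof (rule inj_onI)
    fix X Y assume "X \<in> A // E" "Y \<in> A // E" "F X = F Y"
    then obtain a a' where a: "a \<in> A" "X = E `` {a}" "a' \<in> A" "Y = E `` {a'}" "E' `` {g a} = E' `` {g a'}"
      using F by (auto elim!: quotientE)
    then have "(g a, g a') \<in> E'" using eq_equiv_class[OF a(5) assms(2)] g assms(4) by blast
    then have "(a, a') \<in> E" using gE a by blast
    then show "X = Y" unfolding a by (rule equiv_class_eq[OF assms(1)])
  qed
  moreover have "F ` (A // E) = A' // E'"
  proof
    show "F ` (A // E) \<subseteq> A' // E'" using F g by (auto elim!: quotientE intro!: quotientI)
    show "A' // E' \<subseteq> F ` (A // E)"
    proof
      fix Y assume "Y \<in> A' // E'"
      then obtain b where b: "b \<in> A'" "Y = E' `` {b}" by (auto elim: quotientE)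
      then obtain a where a: "a \<in> A" "R a b" using r by blast
      have "(a, a) \<in> E" using a assms(1,3) by (auto simp: equiv_def refl_on_def)
      then have "(g a, b) \<in> E'" using cong[of a "g a" a b] a g b by blast
      then have "F (E `` {a}) = Y" unfolding F[OF a(1)] b(2) by (rule equiv_class_eq[OF assms(2)])
      then show "Y \<in> F ` (A // E)" using a by (auto intro: quotientI)
    qed
  qed
  ultimately show ?thesis unfolding bij_betw_def by blast
qed

lemma card_quotient_eq_1:
  assumes "equiv U E" "A \<subseteq> U" "a \<in> A" "\<And>b. b \<in> A \<Longrightarrow> (a, b) \<in> E"
  shows "card (A // E) = 1"
proof -
  have "A // E = {E `` {a}}"
  proof (intro equalityI subsetI)
    fix X assume "X \<in> A // E"
    then obtain b where "b \<in> A" "X = E `` {b}" by (rule quotientE)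
    then show "X \<in> {E `` {a}}" using equiv_class_eq[OF assms(1) assms(4)] by simp
  qed (use assms(3) in \<open>auto intro: quotientI\<close>)
  then show ?thesis by simp
qed

text \<open>Sorts the pairs by the set \<open>H k\<close> that holds their first component; fibres
  over the same \<open>H k\<close> have equal size. Taking for \<open>R\<close> the flags or their
  converse gives the two evaluations behind associativity.\<close>

lemma card_eq_sum_fibres:
  assumes "finite K" "\<And>k. k \<in> K \<Longrightarrow> finite (H k)"
    and disj: "\<And>k k' s. k \<in> K \<Longrightarrow> k' \<in> K \<Longrightarrow> s \<in> H k \<Longrightarrow> s \<in> H k' \<Longrightarrow> k = k'"
    and cover: "\<And>s t. (s, t) \<in> R \<Longrightarrow> \<exists>k \<in> K. s \<in> H k"
    and fibre: "\<And>k s. k \<in> K \<Longrightarrow> s \<in> H k \<Longrightarrow> finite {t. (s, t) \<in> R} \<and> card {t. (s, t) \<in> R} = b k"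
  shows "card R = (\<Sum>k\<in>K. card (H k) * b k)"
proof -
  define S where "S k = (SIGMA s:H k. {t. (s, t) \<in> R})" for k
  have "R = (\<Union>k\<in>K. S k)" using cover by (auto simp: S_def)
  also have "card \<dots> = (\<Sum>k\<in>K. card (S k))"
    by (rule card_UN_disjoint) (use assms(1,2) fibre disj in \<open>auto simp: S_def\<close>)
  also have "\<dots> = (\<Sum>k\<in>K. card (H k) * b k)"
    using assms(2) fibre by (intro sum.cong) (auto simp: S_def)
  finally show ?thesis .
qed

section \<open>Hall numbers through monomorphisms\<close>

context proto_abelian
begin

abbreviation sub_class :: "'a \<Rightarrow> 'a set" where
  "sub_class f \<equiv> subobject_equiv C (Cod C f) `` {f}"

text \<open>For monic \<open>f\<close> with target M this says that the quotient of M by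
  \<open>f\<close> is isomorphic to \<open>N\<close>; by \<open>has_quot_exact\<close> it may be
  tested on any one quotient.\<close>

definition has_quot :: "'a \<Rightarrow> 'o \<Rightarrow> bool" where
  "has_quot f N \<longleftrightarrow> (\<exists>q. exact C f q \<and> isomorphic C (Cod C q) N)"

definition hall_monos :: "'o \<Rightarrow> 'o \<Rightarrow> 'o \<Rightarrow> 'a set" where
  "hall_monos N L M = {f. monic C f \<and> Cod C f = M \<and> isomorphic C (Dom C f) L \<and> has_quot f N}"

lemma exact_quot_isomorphic: "exact C i q \<Longrightarrow> exact C i q' \<Longrightarrow> isomorphic C (Cod C q) (Cod C q')"
  by (erule exact_quot_unique, assumption) (auto dest: isomorphicI)

lemma has_quot_exact: "exact C f q \<Longrightarrow> has_quot f N \<longleftrightarrow> isomorphic C (Cod C q) N"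
  unfolding has_quot_def by (meson exact_quot_isomorphic isomorphic_sym isomorphic_trans)

lemma has_quot_unique: "has_quot f N \<Longrightarrow> has_quot f N' \<Longrightarrow> isomorphic C N N'"
  unfolding has_quot_def by (meson exact_quot_isomorphic isomorphic_sym isomorphic_trans)

lemma has_quot_iso_left:
  assumes "has_quot f N" "iso_arrow C a" "Cod C a = Dom C f"
  shows "has_quot (f \<bullet> a) N"
  using assms exact_iso_left unfolding has_quot_def by blast

lemma hall_monos_iso_left:
  assumes f: "f \<in> hall_monos N L M" and a: "iso_arrow C a" "Cod C a = Dom C f"
  shows "f \<bullet> a \<in> hall_monos N L M"
proof -
  have aA: "a \<in> Arr C" and fA: "f \<in> Arr C"
    using a f by (auto simp: iso_arrow_def hall_monos_def monic_arr)
  have "isomorphic C (Dom C a) L"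
    using f isomorphicI[OF a(1)] unfolding a(2) hall_monos_def by (auto intro: isomorphic_trans)
  then show ?thesis using f a aA fA has_quot_iso_left[of f N a] monic_comp[OF iso_monic[OF a(1)], of f]
    by (simp add: hall_monos_def)
qed

lemma sub_equivE:
  assumes "(f, f') \<in> subobject_equiv C M"
  obtains h where "iso_arrow C h" "Dom C h = Dom C f" "Cod C h = Dom C f'" "f' \<bullet> h = f"
    "monic C f" "monic C f'" "Cod C f = M" "Cod C f' = M"
  using assms by (auto simp: subobject_equiv_def homset_def)

lemma sub_equiv_sym: "(f, f') \<in> subobject_equiv C M \<Longrightarrow> (f', f) \<in> subobject_equiv C M"
  by (simp add: subobject_equiv_iff)

lemma hall_monos_cong:
  assumes "(f, f') \<in> subobject_equiv C M" "f' \<in> hall_monos N L M"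
  shows "f \<in> hall_monos N L M"
proof -
  obtain h where "iso_arrow C h" "Dom C h = Dom C f" "Cod C h = Dom C f'" "f' \<bullet> h = f"
    using assms(1) by (rule sub_equivE)
  then show ?thesis using hall_monos_iso_left[OF assms(2), of h] by simp
qed

lemma is_quotient_has_quot: "monic C f \<Longrightarrow> (\<exists>Q. is_quotient C f Q \<and> isomorphic C Q N) \<longleftrightarrow> has_quot f N"
  by (auto simp: is_quotient_iff has_quot_def)

lemma sub_class_eq_iff:
  assumes "monic C f" "monic C f'" "Cod C f = M" "Cod C f' = M"
  shows "sub_class f = sub_class f' \<longleftrightarrow> (f, f') \<in> subobject_equiv C M"
  unfolding assms(3,4) using assms by (intro eq_equiv_class_iff[OF equiv_subobject_equiv]) auto

text \<open>A class with one good member \<open>f\<close> is the class of \<open>f\<close>. This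
  presents the counted subobjects as a quotient of a set of monomorphisms, the shape that
  \<open>bij_betw_quotient\<close> expects.\<close>

lemma hall_subobjects_eq: "hall_subobjects C N L M = hall_monos N L M // subobject_equiv C M"
proof (intro equalityI subsetI)
  fix S assume S: "S \<in> hall_subobjects C N L M"
  then obtain f where f: "f \<in> S" "isomorphic C (Dom C f) L" "\<exists>Q. is_quotient C f Q \<and> isomorphic C Q N"
    and sub: "S \<in> subobjects C M" by (auto simp: hall_subobjects_def)
  obtain g where g: "monic C g" "Cod C g = M" "S = subobject_equiv C M `` {g}"
    using sub by (auto simp: subobjects_def elim!: quotientE)
  have gf: "(g, f) \<in> subobject_equiv C M" using f(1) g(3) by simp
  then have "f \<in> hall_monos N L M" using f is_quotient_has_quot by (auto simp: hall_monos_def elim!: sub_equivE)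
  moreover have "S = subobject_equiv C M `` {f}"
    unfolding g(3) by (rule equiv_class_eq[OF equiv_subobject_equiv gf])
  ultimately show "S \<in> hall_monos N L M // subobject_equiv C M" by (auto intro: quotientI)
next
  fix S assume "S \<in> hall_monos N L M // subobject_equiv C M"
  then obtain f where f: "f \<in> hall_monos N L M" "S = subobject_equiv C M `` {f}" by (rule quotientE)
  then have fm: "monic C f" "Cod C f = M" by (auto simp: hall_monos_def)
  then have "f \<in> S" unfolding f(2) by (intro equiv_class_self[OF equiv_subobject_equiv]) simp
  moreover have "S \<in> subobjects C M" unfolding f(2) subobjects_def using fm by (auto intro: quotientI)
  ultimately show "S \<in> hall_subobjects C N L M"
    using f(1) is_quotient_has_quot[OF fm(1)] unfolding hall_subobjects_def hall_monos_def by blast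
qed

text \<open>The conditions are invariant under isomorphism over \<open>M\<close>, so any
  representative may be tested and not only the one that the definition provides.\<close>

lemma sub_class_in_hall_subobjects_iff:
  assumes "monic C f" "Cod C f = M"
  shows "sub_class f \<in> hall_subobjects C N L M \<longleftrightarrow> f \<in> hall_monos N L M"
proof
  assume "sub_class f \<in> hall_subobjects C N L M"
  then obtain g where g: "g \<in> hall_monos N L M" "sub_class f = subobject_equiv C M `` {g}"
    unfolding hall_subobjects_eq by (auto elim: quotientE)
  then have "sub_class f = sub_class g" by (simp add: hall_monos_def)
  then have "(f, g) \<in> subobject_equiv C M" using sub_class_eq_iff[of f g M] g(1) assms by (simp add: hall_monos_def)
  then show "f \<in> hall_monos N L M" using g(1) by (rule hall_monos_cong)
qed (use assms in \<open>auto simp: hall_subobjects_eq intro: quotientI\<close>)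

lemma hall_subobjectsE:
  assumes "S \<in> hall_subobjects C N L M"
  obtains f where "f \<in> hall_monos N L M" "S = sub_class f" "monic C f" "Cod C f = M"
    "isomorphic C (Dom C f) L" "has_quot f N"
  using assms unfolding hall_subobjects_eq by (auto simp: hall_monos_def elim!: quotientE)

lemma hall_monos_subset: "hall_monos N L M \<subseteq> {f. monic C f \<and> Cod C f = M}"
  by (auto simp: hall_monos_def)

lemma le_sub_comp_iff:
  assumes "monic C x" "f \<in> Arr C" "f' \<in> Arr C" "Cod C f = Dom C x" "Cod C f' = Dom C x"
  shows "le_sub (x \<bullet> f) (x \<bullet> f') \<longleftrightarrow> le_sub f f'"
proof
  note x = monic_arr[OF assms(1)]
  assume "le_sub (x \<bullet> f) (x \<bullet> f')"
  then obtain h where h: "h \<in> Arr C" "Dom C h = Dom C f" "Cod C h = Dom C f'" "(x \<bullet> f') \<bullet> h = x \<bullet> f"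
    using assms x by (auto elim!: le_subE)
  then have "x \<bullet> f' \<bullet> h = x \<bullet> f" using assms x by (simp add: comp_assoc)
  then have "f' \<bullet> h = f" by (rule monicD[OF assms(1)]) (use assms h(1-3) x in auto)
  then show "le_sub f f'" using h by (intro le_subI[of h]) auto
next
  note x = monic_arr[OF assms(1)]
  assume "le_sub f f'"
  then obtain h where h: "h \<in> Arr C" "Dom C h = Dom C f" "Cod C h = Dom C f'" "f' \<bullet> h = f" by (rule le_subE)
  have "(x \<bullet> f') \<bullet> h = x \<bullet> f" using assms x h(1-3) unfolding h(4)[symmetric] by (simp add: comp_assoc)
  then show "le_sub (x \<bullet> f) (x \<bullet> f')" using assms x h by (intro le_subI[of h]) auto
qed

lemma hall_monos_iso_mid:
  assumes f: "f \<in> hall_monos N L M" and b: "iso_arrow C b" "Dom C b = M"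
    and "isomorphic C N N'" "isomorphic C L L'"
  shows "b \<bullet> f \<in> hall_monos N' L' (Cod C b)"
proof -
  have fm: "monic C f" "Cod C f = M" "f \<in> Arr C" using f by (auto simp: hall_monos_def monic_arr)
  have bA: "b \<in> Arr C" using b by (simp add: iso_arrow_def)
  obtain q where q: "exact C f q" "isomorphic C (Cod C q) N" using f by (auto simp: hall_monos_def has_quot_def)
  obtain q' where "exact C (b \<bullet> f) q'" "Cod C q' = Cod C q" using exact_iso_mid[OF q(1) b(1)] fm b by auto
  then have "has_quot (b \<bullet> f) N'" using q(2) assms(4) isomorphic_trans unfolding has_quot_def by metis
  moreover have "monic C (b \<bullet> f)" using monic_comp[OF fm(1) iso_monic[OF b(1)]] fm b by simp
  moreover have "isomorphic C (Dom C f) L'" using f assms(5) isomorphic_trans unfolding hall_monos_def by blast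
  ultimately show ?thesis using fm b bA by (simp add: hall_monos_def)
qed

text \<open>An isomorphism \<open>b\<close> of the ambient objects transports subobjects by
  composition, while \<open>N\<close> and \<open>L\<close> enter only through isomorphism
  conditions. This is why the structure constants do not depend on representatives.\<close>

lemma hall_subobjects_cong:
  assumes "isomorphic C N N'" "isomorphic C L L'" "isomorphic C M M'"
  shows "\<exists>F. bij_betw F (hall_subobjects C N L M) (hall_subobjects C N' L' M')"
proof -
  obtain b where b0: "iso_arrow C b" "b \<in> Arr C" "Dom C b = M" "Cod C b = M'" using assms(3) by (rule isomorphicE)
  obtain b' where b: "b' \<in> Arr C" "Dom C b' = Cod C b" "Cod C b' = Dom C b" "b \<bullet> b' = Ide C (Cod C b)" "iso_arrow C b'"
    using b0(1) by (rule iso_arrowE)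
  show ?thesis unfolding hall_subobjects_eq
  proof (rule bij_betw_quotient[where R = "\<lambda>f f'. f' = b \<bullet> f", OF equiv_subobject_equiv equiv_subobject_equiv
        hall_monos_subset hall_monos_subset])
    fix f assume f: "f \<in> hall_monos N L M"
    then show "\<exists>f'\<in>hall_monos N' L' M'. f' = b \<bullet> f" using hall_monos_iso_mid[OF f b0(1,3) assms(1,2)] b0 by simp
  next
    fix f' assume f': "f' \<in> hall_monos N' L' M'"
    have "b' \<bullet> f' \<in> hall_monos N L (Cod C b')"
      by (rule hall_monos_iso_mid[OF f' b(5)]) (use b b0 assms in \<open>auto intro: isomorphic_sym\<close>)
    moreover have "f' = b \<bullet> b' \<bullet> f'"
    proof -
      have f: "f' \<in> Arr C" "Cod C f' = M'" using f' by (auto simp: hall_monos_def monic_arr)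
      then have "b \<bullet> b' \<bullet> f' = (b \<bullet> b') \<bullet> f'" using b0 b(1-3) by (simp add: comp_assoc)
      also have "\<dots> = f'" unfolding b(4) using f b0 by simp
      finally show ?thesis ..
    qed
    ultimately show "\<exists>f\<in>hall_monos N L M. f' = b \<bullet> f" using b b0 by auto
  next
    fix f f1 g g1 assume "g = b \<bullet> f" "g1 = b \<bullet> f1" and f: "f \<in> hall_monos N L M" "f1 \<in> hall_monos N L M"
      "g \<in> hall_monos N' L' M'" "g1 \<in> hall_monos N' L' M'"
    moreover have "f \<in> Arr C" "f1 \<in> Arr C" using f by (auto simp: hall_monos_def monic_arr)
    ultimately show "(f, f1) \<in> subobject_equiv C M \<longleftrightarrow> (g, g1) \<in> subobject_equiv C M'"
      using iso_monic[OF b0(1)] b0 by (auto simp: subobject_equiv_iff le_sub_comp_iff hall_monos_def)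
  qed
qed

lemma hall_number_cong:
  assumes "isomorphic C N N'" "isomorphic C L L'" "isomorphic C M M'"
  shows "hall_number C N L M = hall_number C N' L' M'"
  using hall_subobjects_cong[OF assms] unfolding hall_number_def by (metis bij_betw_same_card)

subsection \<open>Flags\<close>

text \<open>A pair of subobjects S \<subseteq> T of \<open>M\<close>: \<open>x\<close> represents T
  and \<open>f\<close> the inclusion of S into T, so \<open>x \<bullet> f\<close> represents S.
  Membership of \<open>f\<close> in \<open>hall_monos\<close> encodes S \<cong> P and T/S \<cong>
  L.\<close>

definition flags :: "'o \<Rightarrow> 'o \<Rightarrow> 'o \<Rightarrow> 'o \<Rightarrow> ('a set \<times> 'a set) set" where
  "flags N L P M = {(sub_class (x \<bullet> f), sub_class x) | x f.
    monic C x \<and> Cod C x = M \<and> has_quot x N \<and> f \<in> hall_monos L P (Dom C x)}"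

text \<open>With T fixed, the candidates for S live in the domain of \<open>x\<close>; composing
  with the monic \<open>x\<close> preserves and reflects inclusion, so none are identified in
  \<open>M\<close>.\<close>

lemma flags_fibre_over_intermediate:
  assumes x: "monic C x" "Cod C x = M" "has_quot x N"
  shows "\<exists>F. bij_betw F (hall_subobjects C L P (Dom C x)) {S. (S, sub_class x) \<in> flags N L P M}"
proof -
  note xA = monic_arr[OF x(1)]
  let ?A = "(\<lambda>f. x \<bullet> f) ` hall_monos L P (Dom C x)"
  have A: "monic C (x \<bullet> f)" "Cod C (x \<bullet> f) = M" "f \<in> Arr C" "Cod C f = Dom C x" "monic C f"
    if "f \<in> hall_monos L P (Dom C x)" for f
    using that x xA monic_comp[of f x] monic_arr[of f] by (auto simp: hall_monos_def)
  have "{S. (S, sub_class x) \<in> flags N L P M} = ?A // subobject_equiv C M"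
  proof (intro equalityI subsetI)
    fix S assume "S \<in> {S. (S, sub_class x) \<in> flags N L P M}"
    then obtain x' f where f: "S = sub_class (x' \<bullet> f)" "sub_class x = sub_class x'" "monic C x'" "Cod C x' = M"
      "f \<in> hall_monos L P (Dom C x')" by (auto simp: flags_def)
    then have fA: "f \<in> Arr C" "Cod C f = Dom C x'" by (auto simp: hall_monos_def monic_arr)
    \<comment> \<open>\<open>x'\<close> may be another representative of T. Moving \<open>f\<close>
      along the isomorphism \<open>h\<close> over \<open>M\<close> leaves the composite into
      \<open>M\<close> unchanged.\<close>
    have "(x', x) \<in> subobject_equiv C M" using f(2) sub_class_eq_iff[OF f(3) x(1) f(4) x(2)] by simp
    then obtain h where h: "iso_arrow C h" "Dom C h = Dom C x'" "Cod C h = Dom C x" "x \<bullet> h = x'" by (rule sub_equivE)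
    have hA: "h \<in> Arr C" using h by (simp add: iso_arrow_def)
    have LL: "isomorphic C L L" "isomorphic C P P"
      using f(5) unfolding hall_monos_def has_quot_def by (auto intro: isomorphic_trans isomorphic_sym)
    have "h \<bullet> f \<in> hall_monos L P (Dom C x)" using hall_monos_iso_mid[OF f(5) h(1,2) LL] h(3) by simp
    moreover have "x' \<bullet> f = x \<bullet> h \<bullet> f" unfolding h(4)[symmetric] using h(1-3) hA xA fA by (simp add: comp_assoc)
    ultimately show "S \<in> ?A // subobject_equiv C M" unfolding f(1) using A(2) by (auto intro!: quotientI)
  next
    fix S assume "S \<in> ?A // subobject_equiv C M"
    then obtain f where "f \<in> hall_monos L P (Dom C x)" "S = subobject_equiv C M `` {x \<bullet> f}"
      by (auto elim!: quotientE)
    then have "S = sub_class (x \<bullet> f)" "f \<in> hall_monos L P (Dom C x)" using A by auto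
    then show "S \<in> {S. (S, sub_class x) \<in> flags N L P M}" using x unfolding flags_def by blast
  qed
  moreover have "\<exists>F. bij_betw F (hall_monos L P (Dom C x) // subobject_equiv C (Dom C x)) (?A // subobject_equiv C M)"
  proof (rule bij_betw_quotient[where R = "\<lambda>f s. s = x \<bullet> f", OF equiv_subobject_equiv equiv_subobject_equiv
        hall_monos_subset])
    fix f f1 s s1 assume "s = x \<bullet> f" "s1 = x \<bullet> f1" "f \<in> hall_monos L P (Dom C x)" "f1 \<in> hall_monos L P (Dom C x)"
    then show "(f, f1) \<in> subobject_equiv C (Dom C x) \<longleftrightarrow> (s, s1) \<in> subobject_equiv C M"
      using A x by (simp add: subobject_equiv_iff le_sub_comp_iff)
  qed (use A in auto)
  ultimately show ?thesis unfolding hall_subobjects_eq by simp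
qed

text \<open>With S fixed, \<open>sub_corr\<close> matches the candidates for T with the subobjects
  of M/S that are isomorphic to \<open>L\<close> and have quotient \<open>N\<close>.\<close>

lemma flags_fibre_over_bottom:
  assumes s: "exact C s q" "Cod C s = M" "isomorphic C (Dom C s) P"
  shows "\<exists>F. bij_betw F (hall_subobjects C N L (Cod C q)) {T. (sub_class s, T) \<in> flags N L P M}"
proof -
  note e = exactD[OF s(1)]
  \<comment> \<open>The representative \<open>s\<close> stays fixed: a flag over its class can be
    rewritten, by moving \<open>f\<close> along an isomorphism, so that the composite is
    \<open>s\<close> itself.\<close>
  let ?A = "{x. monic C x \<and> Cod C x = M \<and> has_quot x N \<and> (\<exists>f \<in> hall_monos L P (Dom C x). x \<bullet> f = s)}"
  have fibre: "{T. (sub_class s, T) \<in> flags N L P M} = ?A // subobject_equiv C M"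
  proof (intro equalityI subsetI)
    fix T assume "T \<in> {T. (sub_class s, T) \<in> flags N L P M}"
    then obtain x f where f: "T = sub_class x" "sub_class s = sub_class (x \<bullet> f)" "monic C x" "Cod C x = M"
      "has_quot x N" "f \<in> hall_monos L P (Dom C x)" by (auto simp: flags_def)
    then have fA: "f \<in> Arr C" "Cod C f = Dom C x" "monic C f" by (auto simp: hall_monos_def monic_arr)
    have xA: "x \<in> Arr C" using f monic_arr by blast
    have "(s, x \<bullet> f) \<in> subobject_equiv C M"
      using sub_class_eq_iff[of s "x \<bullet> f" M] f fA xA e s(2) monic_comp[OF fA(3) f(3)] by simp
    then obtain h where h: "iso_arrow C h" "Dom C h = Dom C s" "Cod C h = Dom C (x \<bullet> f)" "(x \<bullet> f) \<bullet> h = s"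
      by (rule sub_equivE)
    have hA: "h \<in> Arr C" "Cod C h = Dom C f" using h fA xA by (simp_all add: iso_arrow_def)
    have "f \<bullet> h \<in> hall_monos L P (Dom C x)" using hall_monos_iso_left[OF f(6) h(1) hA(2)] .
    moreover have "x \<bullet> f \<bullet> h = s" using h(4) comp_assoc[of h f x] hA fA xA by simp
    ultimately have "x \<in> ?A" using f by blast
    then show "T \<in> ?A // subobject_equiv C M" unfolding f(1) f(4) by (rule quotientI)
  next
    fix T assume "T \<in> ?A // subobject_equiv C M"
    then obtain x f where f: "monic C x" "Cod C x = M" "has_quot x N" "f \<in> hall_monos L P (Dom C x)" "x \<bullet> f = s"
      "T = subobject_equiv C M `` {x}" by (auto elim!: quotientE)
    then have "(sub_class (x \<bullet> f), sub_class x) \<in> flags N L P M" unfolding flags_def by blast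
    then show "T \<in> {T. (sub_class s, T) \<in> flags N L P M}" using f by simp
  qed
  have "\<exists>F. bij_betw F (hall_monos N L (Cod C q) // subobject_equiv C (Cod C q)) (?A // subobject_equiv C M)"
  proof (rule bij_betw_quotient[where R = "\<lambda>y x. sub_corr q x y", OF equiv_subobject_equiv equiv_subobject_equiv
        hall_monos_subset])
    fix y assume y: "y \<in> hall_monos N L (Cod C q)"
    then have ym: "monic C y" "Cod C y = Cod C q" by (auto simp: hall_monos_def)
    obtain x where x: "sub_corr q x y" using sub_corr_pullback[OF e(2) ym] .
    obtain f p where f: "exact C f p" "Cod C f = Dom C x" "x \<bullet> f = s" "Dom C f = Dom C s"
      "Cod C p = Dom C y" "q \<bullet> x = y \<bullet> p" using sub_corr_exact[OF s(1) x] .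
    have xm: "monic C x" "Cod C x = M" using x e s by (auto elim: sub_corrE)
    \<comment> \<open>The domain of \<open>y\<close> is a cokernel of \<open>f\<close>, that is T/S,
      so the condition on \<open>y\<close> becomes T/S \<cong> L.\<close>
    have "has_quot f L" using y f(5) has_quot_exact[OF f(1)] by (simp add: hall_monos_def)
    then have "f \<in> hall_monos L P (Dom C x)" using f s exactD[OF f(1)] by (simp add: hall_monos_def)
    moreover obtain r where r: "exact C y r" "isomorphic C (Cod C r) N"
      using y by (auto simp: hall_monos_def has_quot_def)
    \<comment> \<open>M/T is computed as the quotient of M/S by \<open>y\<close>.\<close>
    have "has_quot x N" unfolding has_quot_exact[OF sub_corr_quotient[OF s(1) x r(1)]]
      using r ym exactD[OF r(1)] e by simp
    ultimately have "x \<in> ?A" using f xm by blast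
    then show "\<exists>x\<in>?A. sub_corr q x y" using x by blast
  next
    fix x assume "x \<in> ?A"
    then obtain f where x: "monic C x" "Cod C x = M" "has_quot x N" and f: "f \<in> hall_monos L P (Dom C x)" "x \<bullet> f = s" by blast
    have fA: "f \<in> Arr C" "Cod C f = Dom C x" using f by (auto simp: hall_monos_def monic_arr)
    obtain y where y: "sub_corr q x y" using sub_corr_pushout[OF s(1) x(1) fA f(2)] .
    have ym: "monic C y" "Cod C y = Cod C q" "x \<in> Arr C" using y by (auto elim: sub_corrE)
    obtain f' p where f': "exact C f' p" "Cod C f' = Dom C x" "x \<bullet> f' = s" "Dom C f' = Dom C s"
      "Cod C p = Dom C y" "q \<bullet> x = y \<bullet> p" using sub_corr_exact[OF s(1) y] .
    \<comment> \<open>\<open>s\<close> factors through the monic \<open>x\<close> in one way only,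
      so the factor supplied by the pullback is the given one.\<close>
    have "f' = f"
      by (rule monicD[OF x(1)]) (use f f' fA exactD[OF f'(1)] comp_simps(2)[OF fA(1) ym(3)] in auto)
    then have "isomorphic C (Dom C y) L" using has_quot_exact[OF f'(1), of L] f f'(5) by (simp add: hall_monos_def)
    moreover obtain r where r: "exact C y r" using ym(1) by (rule exact_ex)
    have "has_quot y N" unfolding has_quot_exact[OF r]
      using has_quot_exact[OF sub_corr_quotient[OF s(1) y r], of N] x(3) ym exactD[OF r] e by simp
    ultimately have "y \<in> hall_monos N L (Cod C q)" using ym by (simp add: hall_monos_def)
    then show "\<exists>y\<in>hall_monos N L (Cod C q). sub_corr q x y" using y by blast
  next
    fix y y' x x' assume R: "sub_corr q x y" "sub_corr q x' y'"
      and m: "y \<in> hall_monos N L (Cod C q)" "y' \<in> hall_monos N L (Cod C q)" "x \<in> ?A" "x' \<in> ?A"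
    then show "(y, y') \<in> subobject_equiv C (Cod C q) \<longleftrightarrow> (x, x') \<in> subobject_equiv C M"
      using sub_corr_le_iff[OF s(1) R] sub_corr_le_iff[OF s(1) R(2,1)]
      by (auto simp: subobject_equiv_iff hall_monos_def)
  qed auto
  then show ?thesis unfolding hall_subobjects_eq fibre .
qed

subsection \<open>The zero object\<close>

text \<open>If the quotient is zero, \<open>q\<close> kills the identity, which therefore factors
  through \<open>f\<close>; a monic with a right inverse is invertible. Conversely an isomorphism is
  epic, so an arrow that kills it is null and factors through the zero object.\<close>

lemma has_quot_zero_iff:
  assumes "zero_object C Z" "monic C f"
  shows "has_quot f Z \<longleftrightarrow> iso_arrow C f"
proof
  note fA = monic_arr[OF assms(2)]
  assume "has_quot f Z"
  then obtain q where q: "exact C f q" "zero_object C (Cod C q)"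
    using isomorphic_zero_iff[OF assms(1)] by (auto simp: has_quot_def)
  note e = exactD[OF q(1)]
  have "le_sub (Ide C (Cod C f)) f"
    by (rule exact_kernel[OF q(1)]) (use e Cod_in[OF fA] null_to_zero[OF _ q(2)] in auto)
  then obtain h where h: "h \<in> Arr C" "Dom C h = Cod C f" "Cod C h = Dom C f" "f \<bullet> h = Ide C (Cod C f)"
    using Cod_in[OF fA] by (auto elim!: le_subE)
  have "f \<bullet> h \<bullet> f = (f \<bullet> h) \<bullet> f" using h(1-3) fA by (simp add: comp_assoc)
  also have "\<dots> = f \<bullet> Ide C (Dom C f)" unfolding h(4) using fA by simp
  finally have "h \<bullet> f = Ide C (Dom C f)"
    by (rule monicD[OF assms(2)]) (use h(1-3) fA Dom_in[OF fA] in auto)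
  then show "iso_arrow C f" using h fA by (intro iso_arrowI[of f h]) auto
next
  note fA = monic_arr[OF assms(2)]
  assume iso: "iso_arrow C f"
  obtain t where t: "t \<in> homset C (Cod C f) Z" using zero_objectD(3)[OF assms(1) Cod_in[OF fA]] by blast
  note t' = homsetD[OF t]
  have z: "zero_object C (Cod C t)" using t' assms by simp
  have "exact C f t"
  proof (rule exactI_cokernel[OF assms(2) zero_epic[OF t'(1) z] t'(2)])
    show "null (t \<bullet> f)" by (rule null_comp_right[OF null_to_zero[OF t'(1) z] fA]) (use t' in simp)
    fix u assume u: "u \<in> Arr C" "Dom C u = Cod C f" "null (u \<bullet> f)"
    obtain w where w: "w \<in> homset C Z (Cod C u)" using zero_objectD(2)[OF assms(1) Cod_in[OF u(1)]] by blast
    note w' = homsetD[OF w]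
    have "null u" using epic_null_cancel[OF iso_epic[OF iso] u(3,1,2)] .
    moreover have "null (w \<bullet> t)" by (rule nullI[OF assms(1) t w refl])
    ultimately have "w \<bullet> t = u" using u w' t' by (intro null_unique) auto
    then show "le_quot u t" using u w' t' by (intro le_quotI[of w]) auto
  qed
  then show "has_quot f Z" unfolding has_quot_def using isomorphic_refl[OF t'(5)] t' by auto
qed

lemma exact_from_zero:
  assumes "f \<in> Arr C" "zero_object C (Dom C f)"
  shows "exact C f (Ide C (Cod C f))"
proof (rule exactI_cokernel)
  note c = Cod_in[OF assms(1)]
  show "null (Ide C (Cod C f) \<bullet> f)" using assms null_from_zero by simp
  show "epic C (Ide C (Cod C f))" using iso_epic[OF iso_Ide[OF c]] .
  fix u assume "u \<in> Arr C" "Dom C u = Cod C f"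
  then show "le_quot u (Ide C (Cod C f))" using c by (intro le_quotI[of u]) auto
qed (use assms zero_monic Cod_in in auto)

text \<open>Only the subobject \<open>M\<close> of itself has zero quotient: the monomorphisms
  concerned are isomorphisms, all equivalent to the identity.\<close>

lemma hall_number_zero_left:
  assumes "zero_object C Z" "M \<in> Obj C"
  shows "hall_number C Z L M = (if isomorphic C L M then 1 else 0)"
proof -
  have mem: "f \<in> hall_monos Z L M \<longleftrightarrow> iso_arrow C f \<and> Cod C f = M \<and> isomorphic C (Dom C f) L" for f
    using has_quot_zero_iff[OF assms(1)] iso_monic by (auto simp: hall_monos_def)
  show ?thesis
  proof (cases "isomorphic C L M")
    case True
    have "card (hall_monos Z L M // subobject_equiv C M) = 1"
    proof (rule card_quotient_eq_1[OF equiv_subobject_equiv hall_monos_subset])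
      show "Ide C M \<in> hall_monos Z L M" using True assms(2) by (simp add: mem iso_Ide isomorphic_sym)
      fix f assume "f \<in> hall_monos Z L M"
      then have f: "iso_arrow C f" "Cod C f = M" by (auto simp: mem)
      have "(f, Ide C M) \<in> subobject_equiv C M" unfolding subobject_equiv_def homset_def
        using f assms(2) iso_monic iso_monic[OF iso_Ide] by (auto simp: iso_arrow_def intro!: exI[of _ f])
      then show "(Ide C M, f) \<in> subobject_equiv C M" by (rule sub_equiv_sym)
    qed
    then show ?thesis using True by (simp add: hall_number_def hall_subobjects_eq)
  next
    case False
    then have "hall_monos Z L M = {}" using mem by (metis equals0I isomorphicI isomorphic_sym isomorphic_trans)
    then show ?thesis using False by (simp add: hall_number_def hall_subobjects_eq)
  qed
qed

text \<open>Only the zero subobject qualifies, and by \<open>exact_from_zero\<close> its quotient is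
  \<open>M\<close> itself.\<close>

lemma hall_number_zero_right:
  assumes "zero_object C Z" "M \<in> Obj C"
  shows "hall_number C N Z M = (if isomorphic C M N then 1 else 0)"
proof -
  have mem: "f \<in> hall_monos N Z M \<longleftrightarrow> f \<in> Arr C \<and> Cod C f = M \<and> zero_object C (Dom C f) \<and> isomorphic C M N" for f
    using has_quot_exact[OF exact_from_zero, of f N] zero_monic[of f] assms(2)
    by (auto simp: hall_monos_def isomorphic_zero_iff[OF assms(1)] monic_arr)
  show ?thesis
  proof (cases "isomorphic C M N")
    case True
    obtain g where g: "g \<in> homset C Z M" using zero_objectD(2)[OF assms] by blast
    note g' = homsetD[OF g]
    have le: "le_sub f f'" if f: "f \<in> hall_monos N Z M" "f' \<in> hall_monos N Z M" for f f'
    proof -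
      have f: "f \<in> Arr C" "Cod C f = M" "zero_object C (Dom C f)" "f' \<in> Arr C" "Cod C f' = M" "zero_object C (Dom C f')"
        using that by (auto simp: mem)
      obtain h where h: "h \<in> homset C (Dom C f) (Dom C f')" using zero_objectD(2)[OF f(3) Dom_in[OF f(4)]] by blast
      note h' = homsetD[OF h]
      have "f' \<bullet> h = f" by (rule null_unique) (use f h' in \<open>auto intro!: null_from_zero\<close>)
      then show ?thesis using h' by (intro le_subI[of h]) auto
    qed
    have "card (hall_monos N Z M // subobject_equiv C M) = 1"
    proof (rule card_quotient_eq_1[OF equiv_subobject_equiv hall_monos_subset])
      show gm: "g \<in> hall_monos N Z M" using True g' assms by (simp add: mem)
      fix f assume f: "f \<in> hall_monos N Z M"
      then show "(g, f) \<in> subobject_equiv C M"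
        using le[OF f gm] le[OF gm f] hall_monos_subset gm by (auto simp: subobject_equiv_iff)
    qed
    then show ?thesis using True by (simp add: hall_number_def hall_subobjects_eq)
  next
    case False
    then have "hall_monos N Z M = {}" using mem by blast
    then show ?thesis using False by (simp add: hall_number_def hall_subobjects_eq)
  qed
qed

end

section \<open>Finiteness from Hom and Ext\<close>

context finitary_proto_abelian
begin

text \<open>Precomposing with an isomorphism from \<open>L\<close> moves a representative of every
  such class into the finite set \<open>homset C L M\<close>.\<close>

lemma finite_hall_subobjects:
  assumes "L \<in> Obj C" "M \<in> Obj C"
  shows "finite (hall_subobjects C N L M)"
proof (rule finite_subset)
  show "finite ((\<lambda>f. subobject_equiv C M `` {f}) ` homset C L M)" using finite_hom assms by blast
  show "hall_subobjects C N L M \<subseteq> (\<lambda>f. subobject_equiv C M `` {f}) ` homset C L M"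
  proof
    fix S assume "S \<in> hall_subobjects C N L M"
    then obtain f where f: "f \<in> hall_monos N L M" "S = sub_class f" "monic C f" "Cod C f = M"
      "isomorphic C (Dom C f) L" by (rule hall_subobjectsE)
    note fA = monic_arr[OF f(3)]
    obtain a where a: "iso_arrow C a" "a \<in> Arr C" "Dom C a = L" "Cod C a = Dom C f"
      using isomorphic_sym[OF f(5)] by (rule isomorphicE)
    have "monic C (f \<bullet> a)" using monic_comp[OF iso_monic[OF a(1)] f(3)] a by simp
    then have "(f \<bullet> a, f) \<in> subobject_equiv C M"
      unfolding subobject_equiv_def homset_def using f(3,4) fA a by (auto intro!: exI[of _ a])
    then have "S = subobject_equiv C M `` {f \<bullet> a}"
      using equiv_class_eq[OF equiv_subobject_equiv] f(2,4) by metis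
    moreover have "f \<bullet> a \<in> homset C L M" using fA a f(4) by (intro homsetI) auto
    ultimately show "S \<in> (\<lambda>f. subobject_equiv C M `` {f}) ` homset C L M" by blast
  qed
qed

lemma hall_number_neq_0_iff:
  "L \<in> Obj C \<Longrightarrow> M \<in> Obj C \<Longrightarrow> hall_number C N L M \<noteq> 0 \<longleftrightarrow> hall_subobjects C N L M \<noteq> {}"
  unfolding hall_number_def using finite_hall_subobjects by (simp add: card_eq_0_iff)

text \<open>A counted subobject exhibits \<open>M\<close> as the middle term of an extension of
  \<open>N\<close> by \<open>L\<close>, and equivalent extensions have isomorphic middle terms. So
  taking middle terms maps the finite set \<open>Ext C N L\<close> onto a set that covers all these
  classes.\<close>

lemma finite_middle_classes:
  assumes "N \<in> Obj C" "L \<in> Obj C"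
  shows "finite {m \<in> iso_classes C. \<exists>M \<in> m. hall_number C N L M \<noteq> 0}"
proof (rule finite_subset)
  let ?F = "\<lambda>X. iso_class C (Cod C (fst (SOME e. e \<in> X)))"
  show "finite (?F ` Ext C N L)" using finite_Ext assms by blast
  show "{m \<in> iso_classes C. \<exists>M \<in> m. hall_number C N L M \<noteq> 0} \<subseteq> ?F ` Ext C N L"
  proof
    fix m assume "m \<in> {m \<in> iso_classes C. \<exists>M \<in> m. hall_number C N L M \<noteq> 0}"
    then obtain M where m: "m \<in> iso_classes C" "M \<in> m" "hall_number C N L M \<noteq> 0" by blast
    have mM: "m = iso_class C M" "M \<in> Obj C" using iso_class_member[OF m(1,2)] by blast+
    obtain S where "S \<in> hall_subobjects C N L M" using m(3) mM(2) assms hall_number_neq_0_iff by blast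
    then obtain f where f: "f \<in> hall_monos N L M" "S = sub_class f" "monic C f" "Cod C f = M"
      "isomorphic C (Dom C f) L" "has_quot f N" by (rule hall_subobjectsE)
    obtain q where q: "exact C f q" "isomorphic C (Cod C q) N" using f(6) by (auto simp: has_quot_def)
    obtain a where a: "iso_arrow C a" "a \<in> Arr C" "Dom C a = L" "Cod C a = Dom C f"
      using isomorphic_sym[OF f(5)] by (rule isomorphicE)
    obtain c where c: "iso_arrow C c" "c \<in> Arr C" "Dom C c = Cod C q" "Cod C c = N" using q(2) by (rule isomorphicE)
    note e = exactD[OF q(1)]
    \<comment> \<open>\<open>extensions\<close> demands the end objects \<open>L\<close> and
      \<open>N\<close> themselves, so the isomorphisms \<open>a\<close> and \<open>c\<close> are
      absorbed into the two arrows.\<close>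
    let ?i = "f \<bullet> a" and ?q = "c \<bullet> q"
    have ex: "exact C ?i ?q" using exact_iso_right[OF exact_iso_left[OF q(1) a(1,4)] c(1,3)] .
    have ext: "(?i, ?q) \<in> extensions C N L" using ex a c e by (simp add: extensions_eq)
    let ?X = "ext_equiv C N L `` {(?i, ?q)}"
    have X: "?X \<in> Ext C N L" unfolding Ext_def using ext by (rule quotientI)
    \<comment> \<open>The identity puts the extension into its own class, so the choice inside
      \<open>?F\<close> returns a member of that class.\<close>
    have "\<exists>f\<in>homset C M M. iso_arrow C f \<and> f \<bullet> ?i = ?i \<and> ?q \<bullet> f = ?q"
      by (rule bexI[of _ "Ide C M"]) (use Ide_in[OF mM(2)] iso_Ide[OF mM(2)] e a c f(4) in auto)
    then have "(?i, ?q) \<in> ?X" using ext e a f(4) unfolding ext_equiv_def by simp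
    then have "(SOME e. e \<in> ?X) \<in> ?X" by (rule someI)
    then obtain i' q' where iq: "(SOME e. e \<in> ?X) = (i', q')" "((?i, ?q), (i', q')) \<in> ext_equiv C N L"
      by (metis Image_singleton_iff surj_pair)
    then obtain h where h: "h \<in> homset C (Cod C ?i) (Cod C i')" "iso_arrow C h" unfolding ext_equiv_def by blast
    have "isomorphic C M (Cod C i')" using isomorphicI[OF h(2)] homsetD[OF h(1)] e a f(4) by simp
    then have "iso_class C M = iso_class C (Cod C i')"
      using iso_class_eq_iff[OF mM(2) homsetD(5)[OF h(1)]] by blast
    then have "iso_class C M = ?F ?X" by (simp only: iq(1) fst_conv)
    then show "m \<in> ?F ` Ext C N L" using X mM by blast
  qed
qed

end

section \<open>The Hall algebra\<close>

lemma frag_cmul_minus_right: "frag_cmul c (a - b) = frag_cmul c a - frag_cmul c b"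
  by (rule poly_mapping_eqI) (simp add: lookup_minus algebra_simps)

lemma frag_extend_diff_fun: "frag_extend (\<lambda>i. f i - g i) x = frag_extend f x - frag_extend g x"
  by (simp add: frag_extend_def frag_cmul_minus_right sum_subtractf)

text \<open>Stated for differences because \<open>free_Abelian_group_induct\<close> builds elements
  from generators by differences; sums are recovered as \<open>x - (- x')\<close>.\<close>

lemma hall_mult_diff_left: "hall_mult C (x - x') y = hall_mult C x y - hall_mult C x' y"
  by (simp add: hall_mult_def frag_extend_diff)

lemma hall_mult_diff_right: "hall_mult C x (y - y') = hall_mult C x y - hall_mult C x y'"
  by (simp add: hall_mult_def frag_extend_diff frag_extend_diff_fun)

lemma hall_mult_zero [simp]: "hall_mult C 0 y = 0" "hall_mult C x 0 = 0"
  using hall_mult_diff_left[of C 0 0 y] hall_mult_diff_right[of C x 0 0] by simp_all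

lemma hall_mult_add_left: "hall_mult C (x + x') y = hall_mult C x y + hall_mult C x' y"
  using hall_mult_diff_left[of C x "- x'" y] hall_mult_diff_left[of C 0 x' y] by simp

lemma hall_mult_add_right: "hall_mult C x (y + y') = hall_mult C x y + hall_mult C x y'"
  using hall_mult_diff_right[of C x y "- y'"] hall_mult_diff_right[of C x 0 y'] by simp

lemma hall_mult_frag_of: "hall_mult C (frag_of n) (frag_of l) = hall_basis_mult C n l"
  by (simp add: hall_mult_def)

section \<open>Structure constants on isomorphism classes\<close>

context finitary_proto_abelian
begin

text \<open>Names the choice hidden in \<open>class_number\<close>, so that it can be compared with
  the Hall numbers of given objects.\<close>

definition rep :: "'o set \<Rightarrow> 'o" where
  "rep m = (SOME M. M \<in> m)"

lemma rep:
  assumes "m \<in> iso_classes C"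
  shows "rep m \<in> m" "rep m \<in> Obj C" "iso_class C (rep m) = m"
proof -
  obtain M where "M \<in> Obj C" "m = iso_class C M"
    using assms by (auto simp: iso_classes_def iso_class_def elim: quotientE)
  then have "M \<in> m" using iso_class_self by simp
  then show "rep m \<in> m" unfolding rep_def by (rule someI)
  note mem = iso_class_member[OF assms this]
  show "rep m \<in> Obj C" by (rule mem(1))
  show "iso_class C (rep m) = m" by (rule mem(2)[symmetric])
qed

lemma rep_iso_class: "A \<in> Obj C \<Longrightarrow> isomorphic C (rep (iso_class C A)) A"
  by (rule iffD1[OF iso_class_eq_iff]) (simp_all add: rep iso_class_in)

lemma class_number_rep: "class_number C n l m = hall_number C (rep n) (rep l) (rep m)"
  by (simp add: class_number_def rep_def)

lemma class_number_iso_class: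
  "N \<in> Obj C \<Longrightarrow> L \<in> Obj C \<Longrightarrow> M \<in> Obj C \<Longrightarrow>
    class_number C (iso_class C N) (iso_class C L) (iso_class C M) = hall_number C N L M"
  unfolding class_number_rep by (intro hall_number_cong rep_iso_class)

abbreviation prod_classes :: "'o set \<Rightarrow> 'o set \<Rightarrow> 'o set set" where
  "prod_classes n l \<equiv> {m \<in> iso_classes C. class_number C n l m \<noteq> 0}"

lemma finite_prod_classes:
  assumes "n \<in> iso_classes C" "l \<in> iso_classes C"
  shows "finite (prod_classes n l)"
proof (rule finite_subset)
  show "prod_classes n l \<subseteq> {m \<in> iso_classes C. \<exists>M \<in> m. hall_number C (rep n) (rep l) M \<noteq> 0}"
    using rep(1) by (auto simp: class_number_rep)
  show "finite {m \<in> iso_classes C. \<exists>M \<in> m. hall_number C (rep n) (rep l) M \<noteq> 0}"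
    using finite_middle_classes rep(2) assms by blast
qed

text \<open>Flags are sorted by T, their second component, which is why the counting lemma is
  applied to the converse relation. Over each T in the class \<open>k\<close> there are
  \<open>hall_number C L P (rep k)\<close> choices of S.\<close>

lemma card_flags_by_intermediate:
  assumes N: "N \<in> Obj C" and L: "L \<in> Obj C" and P: "P \<in> Obj C" and M: "M \<in> Obj C"
  shows "card (flags N L P M) =
    (\<Sum>k \<in> prod_classes (iso_class C L) (iso_class C P). hall_number C N (rep k) M * hall_number C L P (rep k))"
proof -
  let ?K = "prod_classes (iso_class C L) (iso_class C P)"
  have "card (flags N L P M) = card ((flags N L P M)\<inverse>)" by (simp add: card_inverse)
  also have "\<dots> = (\<Sum>k\<in>?K. card (hall_subobjects C N (rep k) M) * hall_number C L P (rep k))"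
  proof (rule card_eq_sum_fibres)
    show "finite ?K" using finite_prod_classes[OF iso_class_in[OF L] iso_class_in[OF P]] .
  next
    fix k assume "k \<in> ?K"
    then show "finite (hall_subobjects C N (rep k) M)" using finite_hall_subobjects rep(2) M by blast
  next
    fix k k' T assume k: "k \<in> ?K" "k' \<in> ?K" and T: "T \<in> hall_subobjects C N (rep k) M" "T \<in> hall_subobjects C N (rep k') M"
    obtain x where x: "T = sub_class x" "monic C x" "Cod C x = M" "isomorphic C (Dom C x) (rep k)"
      using T(1) by (rule hall_subobjectsE)
    have "isomorphic C (Dom C x) (rep k')"
      using T(2) sub_class_in_hall_subobjects_iff[OF x(2,3)] x(1) by (simp add: hall_monos_def)
    then have "isomorphic C (rep k) (rep k')" using x(4) isomorphic_sym isomorphic_trans by blast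
    then show "k = k'" using iso_class_eq_iff[of "rep k" "rep k'"] rep k by simp
  next
    fix T S assume "(T, S) \<in> (flags N L P M)\<inverse>"
    then obtain x f where x: "T = sub_class x" "monic C x" "Cod C x = M" "has_quot x N"
      and f: "f \<in> hall_monos L P (Dom C x)" by (auto simp: flags_def)
    let ?k = "iso_class C (Dom C x)"
    have D: "Dom C x \<in> Obj C" using Dom_in[OF monic_arr[OF x(2)]] .
    have k: "?k \<in> iso_classes C" using D by (rule iso_class_in)
    have "hall_subobjects C L P (Dom C x) \<noteq> {}" using f unfolding hall_subobjects_eq by (auto intro: quotientI)
    \<comment> \<open>The subobject given by \<open>f\<close> is itself counted, so the class of T
      occurs in the finite index set.\<close>
    then have "?k \<in> ?K" using k hall_number_neq_0_iff[OF P D] class_number_iso_class[OF L P D] by simp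
    moreover have "T \<in> hall_subobjects C N (rep ?k) M"
      unfolding x(1) sub_class_in_hall_subobjects_iff[OF x(2,3)]
      using x rep_iso_class[OF D] by (simp add: hall_monos_def isomorphic_sym)
    ultimately show "\<exists>k\<in>?K. T \<in> hall_subobjects C N (rep k) M" by blast
  next
    fix k T assume k: "k \<in> ?K" and T: "T \<in> hall_subobjects C N (rep k) M"
    obtain x where x: "T = sub_class x" "monic C x" "Cod C x = M" "isomorphic C (Dom C x) (rep k)" "has_quot x N"
      using T(1) by (rule hall_subobjectsE)
    have D: "Dom C x \<in> Obj C" using Dom_in[OF monic_arr[OF x(2)]] .
    obtain F where F: "bij_betw F (hall_subobjects C L P (Dom C x)) {S. (T, S) \<in> (flags N L P M)\<inverse>}"
      using flags_fibre_over_intermediate[OF x(2,3,5)] unfolding x(1) by auto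
    have "hall_number C L P (Dom C x) = hall_number C L P (rep k)"
      using x(4) L P by (intro hall_number_cong isomorphic_refl)
    then show "finite {S. (T, S) \<in> (flags N L P M)\<inverse>} \<and> card {S. (T, S) \<in> (flags N L P M)\<inverse>} = hall_number C L P (rep k)"
      using bij_betw_finite[OF F] bij_betw_same_card[OF F] finite_hall_subobjects[OF P D]
      by (simp add: hall_number_def)
  qed
  finally show ?thesis by (simp add: hall_number_def)
qed

text \<open>Flags are sorted by the class \<open>k\<close> of M/S;
  \<open>flags_fibre_over_bottom\<close> turns the choices of T over S into subobjects of
  M/S.\<close>

lemma card_flags_by_quotient:
  assumes N: "N \<in> Obj C" and L: "L \<in> Obj C" and P: "P \<in> Obj C" and M: "M \<in> Obj C"
  shows "card (flags N L P M) =
    (\<Sum>k \<in> prod_classes (iso_class C N) (iso_class C L). hall_number C (rep k) P M * hall_number C N L (rep k))"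
proof -
  let ?K = "prod_classes (iso_class C N) (iso_class C L)"
  have "card (flags N L P M) = (\<Sum>k\<in>?K. card (hall_subobjects C (rep k) P M) * hall_number C N L (rep k))"
  proof (rule card_eq_sum_fibres)
    show "finite ?K" using finite_prod_classes[OF iso_class_in[OF N] iso_class_in[OF L]] .
  next
    fix k assume "k \<in> ?K"
    then show "finite (hall_subobjects C (rep k) P M)" using finite_hall_subobjects P M by blast
  next
    fix k k' S assume k: "k \<in> ?K" "k' \<in> ?K" and S: "S \<in> hall_subobjects C (rep k) P M" "S \<in> hall_subobjects C (rep k') P M"
    obtain s where s: "S = sub_class s" "monic C s" "Cod C s = M" "has_quot s (rep k)"
      using S(1) by (rule hall_subobjectsE)
    have "has_quot s (rep k')"
      using S(2) sub_class_in_hall_subobjects_iff[OF s(2,3)] s(1) by (simp add: hall_monos_def)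
    then have "isomorphic C (rep k) (rep k')"
      using has_quot_unique[OF s(4)] by blast
    then show "k = k'" using iso_class_eq_iff[of "rep k" "rep k'"] rep k by simp
  next
    fix S T assume ST: "(S, T) \<in> flags N L P M"
    then obtain x f where x: "S = sub_class (x \<bullet> f)" "monic C x" "Cod C x = M"
      and f: "f \<in> hall_monos L P (Dom C x)" by (auto simp: flags_def)
    have f': "f \<in> Arr C" "Cod C f = Dom C x" "monic C f" "isomorphic C (Dom C f) P" "x \<in> Arr C"
      using f x by (auto simp: hall_monos_def monic_arr)
    let ?s = "x \<bullet> f"
    have s: "monic C ?s" "Cod C ?s = M" "isomorphic C (Dom C ?s) P" using f' x monic_comp by simp_all
    obtain q where q: "exact C ?s q" using s(1) by (rule exact_ex)
    let ?k = "iso_class C (Cod C q)"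
    have D: "Cod C q \<in> Obj C" using Cod_in exactD(4)[OF q] by blast
    have k: "?k \<in> iso_classes C" using D by (rule iso_class_in)
    obtain F where F: "bij_betw F (hall_subobjects C N L (Cod C q)) {T. (S, T) \<in> flags N L P M}"
      using flags_fibre_over_bottom[OF q s(2,3)] unfolding x(1) by blast
    \<comment> \<open>The fibre over S contains T, so the set in bijection with it is nonempty and
      the class of M/S lies in the index set.\<close>
    have "hall_subobjects C N L (Cod C q) \<noteq> {}" using F ST by (auto simp: bij_betw_def)
    then have "?k \<in> ?K" using k hall_number_neq_0_iff[OF L D] class_number_iso_class[OF N L D] by simp
    moreover have "S \<in> hall_subobjects C (rep ?k) P M"
      unfolding x(1) sub_class_in_hall_subobjects_iff[OF s(1,2)]
      using s has_quot_exact[OF q] isomorphic_sym[OF rep_iso_class[OF D]] by (simp add: hall_monos_def)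
    ultimately show "\<exists>k\<in>?K. S \<in> hall_subobjects C (rep k) P M" by blast
  next
    fix k S assume k: "k \<in> ?K" and S: "S \<in> hall_subobjects C (rep k) P M"
    obtain s where s: "S = sub_class s" "monic C s" "Cod C s = M" "isomorphic C (Dom C s) P" "has_quot s (rep k)"
      using S(1) by (rule hall_subobjectsE)
    obtain q where q: "exact C s q" "isomorphic C (Cod C q) (rep k)" using s(5) by (auto simp: has_quot_def)
    have D: "Cod C q \<in> Obj C" using Cod_in exactD(4)[OF q(1)] by blast
    obtain F where F: "bij_betw F (hall_subobjects C N L (Cod C q)) {T. (S, T) \<in> flags N L P M}"
      using flags_fibre_over_bottom[OF q(1) s(3,4)] unfolding s(1) by blast
    have "hall_number C N L (Cod C q) = hall_number C N L (rep k)"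
      using q(2) N L by (intro hall_number_cong isomorphic_refl)
    then show "finite {T. (S, T) \<in> flags N L P M} \<and> card {T. (S, T) \<in> flags N L P M} = hall_number C N L (rep k)"
      using bij_betw_finite[OF F] bij_betw_same_card[OF F] finite_hall_subobjects[OF L D]
      by (simp add: hall_number_def)
  qed
  then show ?thesis by (simp add: hall_number_def)
qed

text \<open>Both sides count the flags for the chosen representatives: on the left \<open>k\<close>
  is the class of M/S, on the right that of T.\<close>

lemma class_number_assoc:
  assumes "n \<in> iso_classes C" "l \<in> iso_classes C" "p \<in> iso_classes C" "m \<in> iso_classes C"
  shows "(\<Sum>k \<in> prod_classes n l. class_number C n l k * class_number C k p m) =
    (\<Sum>k \<in> prod_classes l p. class_number C l p k * class_number C n k m)"
proof -
  note O = assms[THEN rep(2)]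
  show ?thesis
    using card_flags_by_intermediate[OF O] card_flags_by_quotient[OF O]
    by (simp add: class_number_rep rep(3) assms mult.commute cong: conj_cong)
qed

lemma lookup_hall_basis_mult:
  assumes "n \<in> iso_classes C" "l \<in> iso_classes C"
  shows "Poly_Mapping.lookup (hall_basis_mult C n l) m = (if m \<in> iso_classes C then int (class_number C n l m) else 0)"
proof -
  have "Poly_Mapping.lookup (hall_basis_mult C n l) m =
      (\<Sum>k\<in>prod_classes n l. int (class_number C n l k) * (if m = k then 1 else 0))"
    by (simp add: hall_basis_mult_def lookup_sum)
  also have "\<dots> = (\<Sum>k\<in>prod_classes n l. if m = k then int (class_number C n l k) else 0)"
    by (rule sum.cong) auto
  \<comment> \<open>Finiteness of the index set is essential here: a sum over an infinite set would
    be 0 by convention.\<close>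
  also have "\<dots> = (if m \<in> iso_classes C then int (class_number C n l m) else 0)"
    using finite_prod_classes[OF assms] by (simp add: sum.delta')
  finally show ?thesis .
qed

lemma keys_hall_mult:
  assumes "Poly_Mapping.keys x \<subseteq> iso_classes C" "Poly_Mapping.keys y \<subseteq> iso_classes C"
  shows "Poly_Mapping.keys (hall_mult C x y) \<subseteq> iso_classes C"
proof -
  have "Poly_Mapping.keys (hall_basis_mult C n l) \<subseteq> iso_classes C" if "n \<in> iso_classes C" "l \<in> iso_classes C" for n l
    using lookup_hall_basis_mult[OF that] by (auto simp: in_keys_iff split: if_splits)
  then show ?thesis using assms unfolding hall_mult_def
    by (intro order.trans[OF keys_frag_extend] UN_least) blast
qed

lemma lookup_assoc_left:
  assumes "n \<in> iso_classes C" "l \<in> iso_classes C" "p \<in> iso_classes C" "m \<in> iso_classes C"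
  shows "Poly_Mapping.lookup (hall_mult C (hall_basis_mult C n l) (frag_of p)) m =
    int (\<Sum>k \<in> prod_classes n l. class_number C n l k * class_number C k p m)"
proof -
  have "hall_mult C (hall_basis_mult C n l) (frag_of p) =
      (\<Sum>k\<in>prod_classes n l. frag_cmul (int (class_number C n l k)) (hall_basis_mult C k p))"
    using finite_prod_classes[OF assms(1,2)]
    by (simp add: hall_mult_def hall_basis_mult_def[of C n l] frag_extend_sum frag_extend_cmul o_def)
  then show ?thesis using assms by (simp add: lookup_sum lookup_hall_basis_mult)
qed

lemma lookup_assoc_right:
  assumes "n \<in> iso_classes C" "l \<in> iso_classes C" "p \<in> iso_classes C" "m \<in> iso_classes C"
  shows "Poly_Mapping.lookup (hall_mult C (frag_of n) (hall_basis_mult C l p)) m =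
    int (\<Sum>k \<in> prod_classes l p. class_number C l p k * class_number C n k m)"
proof -
  have "hall_mult C (frag_of n) (hall_basis_mult C l p) =
      (\<Sum>k\<in>prod_classes l p. frag_cmul (int (class_number C l p k)) (hall_basis_mult C n k))"
    using finite_prod_classes[OF assms(2,3)]
    by (simp add: hall_mult_def hall_basis_mult_def[of C l p] frag_extend_sum frag_extend_cmul o_def)
  then show ?thesis using assms by (simp add: lookup_sum lookup_hall_basis_mult)
qed

lemma hall_mult_assoc_basis:
  assumes "n \<in> iso_classes C" "l \<in> iso_classes C" "p \<in> iso_classes C"
  shows "hall_mult C (hall_mult C (frag_of n) (frag_of l)) (frag_of p) =
    hall_mult C (frag_of n) (hall_mult C (frag_of l) (frag_of p))" (is "?x = ?y")
proof (rule poly_mapping_eqI)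
  fix m
  show "Poly_Mapping.lookup ?x m = Poly_Mapping.lookup ?y m"
  proof (cases "m \<in> iso_classes C")
    case True
    show ?thesis unfolding hall_mult_frag_of lookup_assoc_left[OF assms True]
        lookup_assoc_right[OF assms True] class_number_assoc[OF assms True] by (rule refl)
  next
    case False
    have "Poly_Mapping.keys ?x \<subseteq> iso_classes C" "Poly_Mapping.keys ?y \<subseteq> iso_classes C"
      using assms by (intro keys_hall_mult; simp)+
    then have "m \<notin> Poly_Mapping.keys ?x" "m \<notin> Poly_Mapping.keys ?y" using False by blast+
    then show ?thesis by (simp add: in_keys_iff)
  qed
qed

text \<open>Both sides are additive in each of the three arguments, so nested inductions reduce the
  claim to generators.\<close>

lemma hall_mult_assoc:
  assumes x: "Poly_Mapping.keys x \<subseteq> iso_classes C" and y: "Poly_Mapping.keys y \<subseteq> iso_classes C"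
    and z: "Poly_Mapping.keys z \<subseteq> iso_classes C"
  shows "hall_mult C (hall_mult C x y) z = hall_mult C x (hall_mult C y z)"
  using x
proof (induction x rule: free_Abelian_group_induct[consumes 1])
  case (3 n)
  show ?case using y
  proof (induction y rule: free_Abelian_group_induct[consumes 1])
    case (3 l)
    show ?case using z
    proof (induction z rule: free_Abelian_group_induct[consumes 1])
      case (3 p)
      then show ?case using \<open>n \<in> iso_classes C\<close> \<open>l \<in> iso_classes C\<close> by (intro hall_mult_assoc_basis)
    qed (simp_all add: hall_mult_diff_right)
  qed (simp_all add: hall_mult_diff_right hall_mult_diff_left)
qed (simp_all add: hall_mult_diff_left)

lemma hall_mult_unit:
  assumes Z: "zero_object C Z" and x: "Poly_Mapping.keys x \<subseteq> iso_classes C"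
  shows "hall_mult C (frag_of (iso_class C Z)) x = x" "hall_mult C x (frag_of (iso_class C Z)) = x"
proof -
  have ZO: "Z \<in> Obj C" using Z by (rule zero_objectD)
  have b: "hall_basis_mult C (iso_class C Z) m = frag_of m" "hall_basis_mult C m (iso_class C Z) = frag_of m"
    if m: "m \<in> iso_classes C" for m
  proof -
    \<comment> \<open>On chosen representatives isomorphism is equality of classes, so the structure
      constants with a zero object become Kronecker deltas.\<close>
    have *: "class_number C (iso_class C Z) m k = (if k = m then 1 else 0)"
      "class_number C m (iso_class C Z) k = (if k = m then 1 else 0)" if k: "k \<in> iso_classes C" for k
    proof -
      note mk = rep[OF m] rep[OF k]
      have "isomorphic C (rep m) (rep k) \<longleftrightarrow> k = m" "isomorphic C (rep k) (rep m) \<longleftrightarrow> k = m"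
        using iso_class_eq_iff[OF mk(2,5)] iso_class_eq_iff[OF mk(5,2)] mk(3,6) by auto
      then show "class_number C (iso_class C Z) m k = (if k = m then 1 else 0)"
        "class_number C m (iso_class C Z) k = (if k = m then 1 else 0)"
        using class_number_iso_class[OF ZO mk(2,5)] class_number_iso_class[OF mk(2) ZO mk(5)]
          hall_number_zero_left[OF Z mk(5)] hall_number_zero_right[OF Z mk(5)] mk(3,6) by simp_all
    qed
    show "hall_basis_mult C (iso_class C Z) m = frag_of m"
      by (rule poly_mapping_eqI) (use m * in \<open>auto simp: lookup_hall_basis_mult[OF iso_class_in[OF ZO] m]\<close>)
    show "hall_basis_mult C m (iso_class C Z) = frag_of m"
      by (rule poly_mapping_eqI) (use m * in \<open>auto simp: lookup_hall_basis_mult[OF m iso_class_in[OF ZO]]\<close>)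
  qed
  show "hall_mult C (frag_of (iso_class C Z)) x = x"
    using x by (induction x rule: free_Abelian_group_induct[consumes 1]) (simp_all add: hall_mult_diff_right hall_mult_frag_of b)
  show "hall_mult C x (frag_of (iso_class C Z)) = x"
    using x by (induction x rule: free_Abelian_group_induct[consumes 1]) (simp_all add: hall_mult_diff_left hall_mult_frag_of b)
qed

lemma ring_hall_ring:
  assumes "zero_object C Z"
  shows "ring (hall_ring C (frag_of (iso_class C Z)))"
proof (rule ringI)
  have car: "x \<in> carrier (hall_ring C u) \<longleftrightarrow> Poly_Mapping.keys x \<subseteq> iso_classes C" for x u
    by (simp add: hall_ring_def)
  have ops: "x \<oplus>\<^bsub>hall_ring C u\<^esub> y = x + y" "x \<otimes>\<^bsub>hall_ring C u\<^esub> y = hall_mult C x y"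
    "\<zero>\<^bsub>hall_ring C u\<^esub> = 0" "\<one>\<^bsub>hall_ring C u\<^esub> = u" for x y u
    by (simp_all add: hall_ring_def)
  note Z = zero_objectD(1)[OF assms]
  show "abelian_group (hall_ring C (frag_of (iso_class C Z)))"
  proof (rule abelian_groupI, unfold car ops)
    fix x :: "'o set \<Rightarrow>\<^sub>0 int" assume x: "Poly_Mapping.keys x \<subseteq> iso_classes C"
    show "\<exists>y\<in>carrier (hall_ring C (frag_of (iso_class C Z))). y + x = 0"
      by (rule bexI[of _ "- x"]) (use x in \<open>simp_all add: car\<close>)
  next
    fix x y :: "'o set \<Rightarrow>\<^sub>0 int"
    assume "Poly_Mapping.keys x \<subseteq> iso_classes C" "Poly_Mapping.keys y \<subseteq> iso_classes C"
    then show "Poly_Mapping.keys (x + y) \<subseteq> iso_classes C" using keys_add[of x y] by blast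
  qed (simp_all add: algebra_simps)
  show "monoid (hall_ring C (frag_of (iso_class C Z)))"
    by (rule monoidI, unfold car ops)
      (use Z assms in \<open>simp_all add: keys_hall_mult hall_mult_assoc hall_mult_unit iso_class_in\<close>)
qed (simp_all add: hall_ring_def hall_mult_add_left hall_mult_add_right)

end

theorem theorem1p6:
  fixes C :: "('o, 'a) precategory"
  assumes "finitary_proto_abelian C"
  shows "(\<forall>N \<in> Obj C. \<forall>L \<in> Obj C. \<forall>M \<in> Obj C. finite (hall_subobjects C N L M)) \<and>
    (\<forall>N \<in> Obj C. \<forall>L \<in> Obj C.
      finite {m \<in> iso_classes C. \<exists>M \<in> m. hall_number C N L M \<noteq> 0}) \<and>
    (\<forall>N \<in> Obj C. \<forall>L \<in> Obj C. \<forall>M \<in> Obj C.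
      Poly_Mapping.lookup
        (hall_mult C (frag_of (iso_class C N)) (frag_of (iso_class C L))) (iso_class C M)
      = int (hall_number C N L M)) \<and>
    (\<exists>u. ring (hall_ring C u))"
proof -
  interpret finitary_proto_abelian C by (rule assms)
  \<comment> \<open>The witness for the unit is the basis element of the class of
    \<open>Z\<close>.\<close>
  obtain Z where "zero_object C Z" using pointed by blast
  then have "\<exists>u. ring (hall_ring C u)" using ring_hall_ring by blast
  then show ?thesis
    using finite_hall_subobjects finite_middle_classes
    by (simp add: hall_mult_frag_of lookup_hall_basis_mult iso_class_in class_number_iso_class)
qed

end
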